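(* Let $\mathsf{X}$ be a finite connected graph with $t\in\{1,2\}$ ramified vertices such that every admissible path has at least one shared edge (with another admissible path). Let $\mathsf{X}_n$ be the $n$-th layer of a $\mathbb{Z}_p$-tower over $\mathsf{X}$ (given by a voltage assignment $\alpha$) in which the ramified vertices are totally ramified and the other vertices unramified. Write $\det(M_\alpha)=p^{\mu}U(T)f(T)$ with $U$ a unit of $\mathbb{Z}_p[[T]]$ and $f$ a distinguished polynomial, and let $\lambda=\deg f$. Then there is a constant $\nu$ such that $\operatorname{ord}_p(F_t(\mathsf{X}_n))=\mu p^n+\lambda n+\nu$ for all $n\gg0$.
   Context: Admissible path: a path between ramified vertices (possibly equal) all of whose intermediate vertices are unramified. $F_t(\mathsf{Y})$ is the number of spanning forests of $\mathsf{Y}$ with $t$ trees each containing exactly one ramified vertex (the ramified vertices of $\mathsf{X}_n$ are the unique preimages of those of $\mathsf{X}$). Tower: $\Gamma\cong\mathbb{Z}_p$ with topological generator $\gamma$, $\Lambda=\mathbb{Z}_p[[\Gamma]]\cong\mathbb{Z}_p[[T]]$ via $\gamma\mapsto1+T$, $\Gamma_n=\Gamma/\Gamma^{p^n}$; voltage assignment $\alpha$ from directed edges to $\Gamma$ with $\alpha(\bar e)=\alpha(e)^{-1}$; $I_v=\Gamma$ for ramified $v$, $I_v=1$ otherwise; $\mathsf{X}_n$ has vertices $\bigsqcup_v\{v\}\times\Gamma_n/\pi_n(I_v)$, directed edges $\mathbf{E}(\mathsf{X})\times\Gamma_n$, $(e,g)$ joining $(o(e),g\pi_n(I_{o(e)}))$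 to $(t(e),g\pi_n(\alpha(e))\pi_n(I_{t(e)}))$; all $\mathsf{X}_n$ connected. Order the vertices $v_1,\dots,v_r$ unramified and $v_{r+1},\dots,v_{r+t}$ ramified. $D$ is the diagonal matrix with entry $\deg(v_i)$ for unramified $v_i$ and $1$ for ramified $v_i$; $A_\alpha=(a_{ij})$ with $a_{ij}=\sum_{e:\ (o(e),t(e))=(v_j,v_i)}\alpha(e)\in\Lambda$ for $j\le r$ and $a_{ij}=0$ for $j>r$; $M_\alpha=D-A_\alpha$. *)

theory Defs
  imports "Berlekamp_Zassenhaus.Finite_Field" "Jordan_Normal_Form.Determinant"
    "HOL-Computational_Algebra.Polynomial_FPS"
begin

section \<open>The p-adic integers Z_p (p = CARD('p)), as compatible residue sequences\<close>

definition padic_set :: "nat \<Rightarrow> (nat \<Rightarrow> int) set" where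
  "padic_set p = {f. \<forall>k l. k \<le> l \<longrightarrow> f l mod (int p) ^ k = f k}"

typedef ('p::nontriv) padic = "padic_set CARD('p)"
  morphisms padic_rep Abs_padic
  by (rule exI[of _ "\<lambda>_. 0"]) (simp add: padic_set_def)

setup_lifting type_definition_padic

lemma padic_set_self: "f \<in> padic_set p \<Longrightarrow> f k mod (int p) ^ k = f k"
  by (simp add: padic_set_def)

lemma padic_set_modI:
  assumes "\<And>k l. k \<le> l \<Longrightarrow> g l mod (int p)^k = g k"
  shows "g \<in> padic_set p" using assms by (simp add: padic_set_def)

lemma pow_dvd_pow_int: "k \<le> l \<Longrightarrow> (int p)^k dvd (int p)^l"
  by (simp add: le_imp_power_dvd)

lemma padic_set_op:
  assumes f: "f \<in> padic_set p" and g: "g \<in> padic_set p"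
    and cong: "\<And>k a b c d. [a = c] (mod (int p)^k) \<Longrightarrow> [b = d] (mod (int p)^k) \<Longrightarrow> [h a b = h c d] (mod (int p)^k)"
  shows "(\<lambda>k. h (f k) (g k) mod (int p)^k) \<in> padic_set p"
proof (rule padic_set_modI)
  fix k l :: nat assume kl: "k \<le> l"
  have "h (f l) (g l) mod (int p)^l mod (int p)^k = h (f l) (g l) mod (int p)^k"
    using kl by (simp add: mod_mod_cancel pow_dvd_pow_int)
  also have "\<dots> = h (f k) (g k) mod (int p)^k"
    using cong[of "f l" "f k" k "g l" "g k"] f g kl unfolding padic_set_def cong_def by auto
  finally show "h (f l) (g l) mod (int p)^l mod (int p)^k = h (f k) (g k) mod (int p)^k" .
qed

instantiation padic :: (nontriv) comm_ring_1
begin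

lift_definition zero_padic :: "'a padic" is "\<lambda>k. 0" by (simp add: padic_set_def)
lift_definition one_padic :: "'a padic" is "\<lambda>k. 1 mod (int CARD('a))^k"
  using padic_set_op[of "\<lambda>_. 0" "CARD('a)" "\<lambda>_. 0" "\<lambda>_ _. 1"]
  by (simp add: padic_set_def)
lift_definition plus_padic :: "'a padic \<Rightarrow> 'a padic \<Rightarrow> 'a padic"
  is "\<lambda>f g k. (f k + g k) mod (int CARD('a))^k"
  by (rule padic_set_op) (auto intro: cong_add)
lift_definition minus_padic :: "'a padic \<Rightarrow> 'a padic \<Rightarrow> 'a padic"
  is "\<lambda>f g k. (f k - g k) mod (int CARD('a))^k"
  by (rule padic_set_op) (auto intro: cong_diff)
lift_definition times_padic :: "'a padic \<Rightarrow> 'a padic \<Rightarrow> 'a padic"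
  is "\<lambda>f g k. (f k * g k) mod (int CARD('a))^k"
  by (rule padic_set_op) (auto intro: cong_mult)
lift_definition uminus_padic :: "'a padic \<Rightarrow> 'a padic"
  is "\<lambda>f k. (- f k) mod (int CARD('a))^k"
proof -
  fix f assume f: "f \<in> padic_set CARD('a)"
  show "(\<lambda>k. (- f k) mod (int CARD('a))^k) \<in> padic_set CARD('a)"
    using padic_set_op[OF f f, of "\<lambda>a b. - a"] by (auto simp: cong_minus_minus_iff)
qed

instance
proof
  fix a b c :: "'a padic"
  show "a + b + c = a + (b + c)"
    by transfer (auto simp: padic_set_self mod_add_left_eq mod_add_right_eq add.assoc)
  show "a + b = b + a" by transfer (auto simp: add.commute)
  show "0 + a = a" by transfer (auto simp: padic_set_self)
  show "- a + a = 0" by transfer (auto simp: padic_set_self mod_add_left_eq)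
  show "a - b = a + - b" by transfer (auto simp: mod_add_right_eq)
  show "a * b * c = a * (b * c)"
    by transfer (auto simp: mod_mult_left_eq mod_mult_right_eq mult.assoc)
  show "a * b = b * a" by transfer (auto simp: mult.commute)
  show "1 * a = a" by transfer (auto simp: padic_set_self mod_mult_left_eq)
  show "(a + b) * c = a * c + b * c"
    by transfer (auto simp: mod_mult_left_eq mod_add_eq distrib_right)
  show "(0::'a padic) \<noteq> 1"
  proof transfer
    have "(1::int) < int CARD('a)" using nontriv by simp
    hence "(\<lambda>k::nat. 0::int) 1 \<noteq> (\<lambda>k. 1 mod int CARD('a) ^ k) 1" by simp
    thus "(\<lambda>k::nat. 0::int) \<noteq> (\<lambda>k. 1 mod int CARD('a) ^ k)" by metis
  qed
qed
end


section \<open>Iwasawa algebra Lambda = Z_p[[T]] and the image of gamma^a, i.e. (1+T)^a\<close>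

text \<open>Binomial coefficient binom(a,i) in Z_p: the unique c with i! * c = a(a-1)...(a-i+1).\<close>
definition padic_binom :: "'p::prime_card padic \<Rightarrow> nat \<Rightarrow> 'p padic" where
  "padic_binom a i = (THE c. of_nat (fact i) * c = (\<Prod>j<i. a - of_nat j))"

text \<open>gamma^a maps to (1+T)^a = sum_i binom(a,i) T^i in Z_p[[T]].\<close>
definition gamma_pow :: "'p::prime_card padic \<Rightarrow> 'p padic fps" where
  "gamma_pow a = Abs_fps (padic_binom a)"

text \<open>pi_n : Z_p -> Z/p^n Z, representative in {0..<p^n}.\<close>
definition padic_res :: "'p::prime_card padic \<Rightarrow> nat \<Rightarrow> int" where
  "padic_res a n = padic_rep a n"

definition distinguished :: "'p::prime_card padic poly \<Rightarrow> bool" where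
  "distinguished f \<longleftrightarrow> lead_coeff f = 1 \<and>
     (\<forall>i<degree f. (of_nat CARD('p) :: 'p padic) dvd coeff f i)"

section \<open>Finite graphs (Serre formalism: directed edges with reversal involution)\<close>

definition fin_graph :: "'v set \<Rightarrow> 'e set \<Rightarrow> ('e \<Rightarrow> 'v) \<Rightarrow> ('e \<Rightarrow> 'v) \<Rightarrow> ('e \<Rightarrow> 'e) \<Rightarrow> bool" where
  "fin_graph V E src tgt rv \<longleftrightarrow> finite V \<and> finite E \<and>
     (\<forall>e\<in>E. src e \<in> V \<and> tgt e \<in> V \<and> rv e \<in> E \<and> rv e \<noteq> e \<and> rv (rv e) = e \<and> src (rv e) = tgt e)"

definition edge_rel :: "'e set \<Rightarrow> ('e \<Rightarrow> 'v) \<Rightarrow> ('e \<Rightarrow> 'v) \<Rightarrow> ('v \<times> 'v) set" where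
  "edge_rel S src tgt = {(src e, tgt e) | e. e \<in> S}"

definition graph_connected :: "'v set \<Rightarrow> 'e set \<Rightarrow> ('e \<Rightarrow> 'v) \<Rightarrow> ('e \<Rightarrow> 'v) \<Rightarrow> bool" where
  "graph_connected V E src tgt \<longleftrightarrow> V \<noteq> {} \<and> (\<forall>u\<in>V. \<forall>w\<in>V. (u, w) \<in> (edge_rel E src tgt)\<^sup>*)"

definition is_walk :: "'e set \<Rightarrow> ('e \<Rightarrow> 'v) \<Rightarrow> ('e \<Rightarrow> 'v) \<Rightarrow> 'e list \<Rightarrow> bool" where
  "is_walk S src tgt es \<longleftrightarrow> es \<noteq> [] \<and> set es \<subseteq> S \<and>
     (\<forall>i. Suc i < length es \<longrightarrow> tgt (es ! i) = src (es ! Suc i))"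

text \<open>No (undirected) edge is used twice, in either direction.\<close>
definition edges_distinct :: "('e \<Rightarrow> 'e) \<Rightarrow> 'e list \<Rightarrow> bool" where
  "edges_distinct rv es \<longleftrightarrow>
     (\<forall>i j. i < j \<longrightarrow> j < length es \<longrightarrow> es ! j \<noteq> es ! i \<and> es ! j \<noteq> rv (es ! i))"

definition has_cycle :: "'e set \<Rightarrow> ('e \<Rightarrow> 'v) \<Rightarrow> ('e \<Rightarrow> 'v) \<Rightarrow> ('e \<Rightarrow> 'e) \<Rightarrow> bool" where
  "has_cycle S src tgt rv \<longleftrightarrow>
     (\<exists>es. is_walk S src tgt es \<and> src (hd es) = tgt (last es) \<and> edges_distinct rv es)"

text \<open>Spanning forest (edge set S closed under reversal, acyclic) whose trees (= connected
  components) each contain exactly one vertex of R.\<close>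
definition rooted_spanning_forest ::
  "'v set \<Rightarrow> 'e set \<Rightarrow> ('e \<Rightarrow> 'v) \<Rightarrow> ('e \<Rightarrow> 'v) \<Rightarrow> ('e \<Rightarrow> 'e) \<Rightarrow> 'v set \<Rightarrow> 'e set \<Rightarrow> bool" where
  "rooted_spanning_forest V E src tgt rv R S \<longleftrightarrow> S \<subseteq> E \<and> (\<forall>e\<in>S. rv e \<in> S) \<and>
     \<not> has_cycle S src tgt rv \<and>
     (\<forall>v\<in>V. \<exists>!r. r \<in> R \<and> (v, r) \<in> (edge_rel S src tgt)\<^sup>*)"

text \<open>F_t(Y) with t = card R.\<close>
definition forest_count ::
  "'v set \<Rightarrow> 'e set \<Rightarrow> ('e \<Rightarrow> 'v) \<Rightarrow> ('e \<Rightarrow> 'v) \<Rightarrow> ('e \<Rightarrow> 'e) \<Rightarrow> 'v set \<Rightarrow> nat" where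
  "forest_count V E src tgt rv R = card {S. rooted_spanning_forest V E src tgt rv R S}"

section \<open>Admissible paths and shared edges\<close>

definition admissible_path ::
  "'e set \<Rightarrow> ('e \<Rightarrow> 'v) \<Rightarrow> ('e \<Rightarrow> 'v) \<Rightarrow> ('e \<Rightarrow> 'e) \<Rightarrow> 'v set \<Rightarrow> 'e list \<Rightarrow> bool" where
  "admissible_path E src tgt rv R es \<longleftrightarrow> is_walk E src tgt es \<and>
     src (hd es) \<in> R \<and> tgt (last es) \<in> R \<and>
     (\<forall>i. Suc i < length es \<longrightarrow> tgt (es ! i) \<notin> R) \<and>
     distinct (map src es) \<and> edges_distinct rv es"

definition reverse_path :: "('e \<Rightarrow> 'e) \<Rightarrow> 'e list \<Rightarrow> 'e list" where
  "reverse_path rv es = rev (map rv es)"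

definition admissible_paths_share_edges ::
  "'e set \<Rightarrow> ('e \<Rightarrow> 'v) \<Rightarrow> ('e \<Rightarrow> 'v) \<Rightarrow> ('e \<Rightarrow> 'e) \<Rightarrow> 'v set \<Rightarrow> bool" where
  "admissible_paths_share_edges E src tgt rv R \<longleftrightarrow>
     (\<forall>P. admissible_path E src tgt rv R P \<longrightarrow>
        (\<exists>Q. admissible_path E src tgt rv R Q \<and> Q \<noteq> P \<and> Q \<noteq> reverse_path rv P \<and>
             (\<exists>e\<in>set P. e \<in> set Q \<or> rv e \<in> set Q)))"

section \<open>The n-th layer X_n of the branched Z_p-tower (Gamma_n = Z/p^n)\<close>

text \<open>Vertices: (v, g) with g in Gamma_n for unramified v; the single vertex (v, 0) for ramified v.\<close>
definition layer_V :: "'v set \<Rightarrow> 'v set \<Rightarrow> int \<Rightarrow> nat \<Rightarrow> ('v \<times> int) set" where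
  "layer_V V R p n = {(v, g) | v g. v \<in> V \<and> (if v \<in> R then g = 0 else 0 \<le> g \<and> g < p ^ n)}"

definition layer_E :: "'e set \<Rightarrow> int \<Rightarrow> nat \<Rightarrow> ('e \<times> int) set" where
  "layer_E E p n = E \<times> {0..<p ^ n}"

definition layer_src :: "('e \<Rightarrow> 'v) \<Rightarrow> 'v set \<Rightarrow> 'e \<times> int \<Rightarrow> 'v \<times> int" where
  "layer_src src R eg = (src (fst eg), if src (fst eg) \<in> R then 0 else snd eg)"

definition layer_tgt :: "('e \<Rightarrow> 'v) \<Rightarrow> 'v set \<Rightarrow> ('e \<Rightarrow> 'p::prime_card padic) \<Rightarrow> nat \<Rightarrow> 'e \<times> int \<Rightarrow> 'v \<times> int" where
  "layer_tgt tgt R \<alpha> n eg = (tgt (fst eg),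
     if tgt (fst eg) \<in> R then 0 else (snd eg + padic_res (\<alpha> (fst eg)) n) mod (int CARD('p)) ^ n)"

definition layer_rv :: "('e \<Rightarrow> 'e) \<Rightarrow> ('e \<Rightarrow> 'p::prime_card padic) \<Rightarrow> nat \<Rightarrow> 'e \<times> int \<Rightarrow> 'e \<times> int" where
  "layer_rv rv \<alpha> n eg = (rv (fst eg), (snd eg + padic_res (\<alpha> (fst eg)) n) mod (int CARD('p)) ^ n)"

definition layer_R :: "'v set \<Rightarrow> ('v \<times> int) set" where
  "layer_R R = (\<lambda>v. (v, 0)) ` R"

section \<open>The matrix M_alpha = D - A_alpha over Lambda, rows/columns indexed by the list vs\<close>

definition M_alpha :: "'v list \<Rightarrow> 'e set \<Rightarrow> ('e \<Rightarrow> 'v) \<Rightarrow> ('e \<Rightarrow> 'v) \<Rightarrow> 'v set \<Rightarrow>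
    ('e \<Rightarrow> 'p::prime_card padic) \<Rightarrow> 'p padic fps mat" where
  "M_alpha vs E src tgt R \<alpha> = mat (length vs) (length vs) (\<lambda>(i, j).
     (if i = j then (if vs ! i \<in> R then 1 else of_nat (card {e \<in> E. src e = vs ! i})) else 0)
     - (if vs ! j \<in> R then 0
        else (\<Sum>e\<in>{e \<in> E. src e = vs ! j \<and> tgt e = vs ! i}. gamma_pow (\<alpha> e))))"

end

theory Submission
  imports Defs
begin

text \<open>
  Deleting an edge from an unramified vertex \<open>v\<close> to a root, or else declaring \<open>v\<close> a new root, shows
  that the number of rooted forests satisfies the same recursion as the determinant of the Laplacian
  with the rows and columns of the roots removed. For \<open>X\<^sub>n\<close> this Laplacian is block circulant, so the
  discrete Fourier transform over \<open>\<complex>\<close> turns \<open>F\<^sub>t(X\<^sub>n)\<close> into the product of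
  \<open>det(M\<^sub>\<alpha>)(\<zeta> - 1)\<close> over the \<open>p^n\<close>-th roots of unity \<open>\<zeta>\<close>.

  To avoid adjoining roots of unity to \<open>\<int>\<^sub>p\<close>, power series are replaced by integer polynomials
  congruent to them modulo \<open>(p^K, T^N)\<close>: the norm from \<open>\<int>[x]/(x^(p^n) - 1)\<close> of a polynomial in
  \<open>T = x - 1\<close> only depends, modulo \<open>p^K\<close>, on its coefficients below \<open>T^(K p^n)\<close> modulo \<open>p^K\<close>.
  The factor \<open>p^\<mu>\<close> has norm \<open>p^(\<mu> p^n)\<close> and the norm of \<open>U\<close> is prime to \<open>p\<close>. Finally \<open>f\<close> is
  congruent to \<open>T^\<lambda>\<close> modulo \<open>p\<close>, and \<open>p\<close> is, up to units, \<open>T^(p^n (p - 1))\<close> at a primitive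
  root of unity of order \<open>p^(n+1)\<close>, so for \<open>p^n > \<lambda>\<close> the norm of \<open>f\<close> gains exactly \<open>\<lambda>\<close> factors \<open>p\<close>
  from level \<open>n\<close> to level \<open>n + 1\<close>.
\<close>

section \<open>Determinants over finite index sets\<close>

text \<open>The Leibniz formula over an arbitrary index set: the matrices below are indexed by
  vertices, and rows and columns are deleted by shrinking the set.\<close>

definition sdet :: "'i set \<Rightarrow> ('i \<Rightarrow> 'i \<Rightarrow> 'a::comm_ring_1) \<Rightarrow> 'a" where
  "sdet S A = (\<Sum>p | p permutes S. of_int (sign p) * (\<Prod>i\<in>S. A i (p i)))"

lemma sdet_cong:
  assumes "\<And>i j. i \<in> S \<Longrightarrow> j \<in> S \<Longrightarrow> A i j = B i j"
  shows "sdet S A = sdet S B"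
  unfolding sdet_def
  by (intro sum.cong refl arg_cong2[where f="(*)"] prod.cong) (auto simp: assms permutes_in_image)

lemma sdet_empty [simp]: "sdet {} A = 1"
  by (simp add: sdet_def)

lemma sdet_singleton [simp]: "sdet {x} A = A x x"
  by (simp add: sdet_def)

text \<open>Conjugation by \<open>h\<close> carries the permutations of \<open>S\<close> to those of
  \<open>T\<close> and keeps signs.\<close>

lemma sdet_reindex:
  assumes h: "bij_betw h S T" and S: "finite S"
  shows "sdet T A = sdet S (\<lambda>i j. A (h i) (h j))"
proof -
  have inj: "inj_on h S" and T: "T = h ` S" using h by (auto simp: bij_betw_def)
  have bij: "bij_betw (map_permutation S h) {p. p permutes S} {p. p permutes T}"
  proof (rule bij_betw_byWitness[where f' = "map_permutation T (inv_into S h)"])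
    have h': "bij_betw (inv_into S h) T S" using h by (rule bij_betw_inv_into)
    show "\<forall>a\<in>{p. p permutes S}. map_permutation T (inv_into S h) (map_permutation S h a) = a"
      using inj by (auto intro!: map_permutation_compose_inv[OF h])
    show "\<forall>a'\<in>{p. p permutes T}. map_permutation S h (map_permutation T (inv_into S h) a') = a'"
      using map_permutation_compose_inv[OF h', of _ h] T by (auto simp: f_inv_into_f)
    show "map_permutation S h ` {p. p permutes S} \<subseteq> {p. p permutes T}"
      using map_permutation_permutes[OF h] by auto
    show "map_permutation T (inv_into S h) ` {p. p permutes T} \<subseteq> {p. p permutes S}"
      using map_permutation_permutes[OF h'] by auto
  qed
  have "sdet T A = (\<Sum>p | p permutes S. of_int (sign (map_permutation S h p))
      * (\<Prod>i\<in>T. A i (map_permutation S h p i)))"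
    unfolding sdet_def using bij by (rule sum.reindex_bij_betw[symmetric])
  also have "\<dots> = sdet S (\<lambda>i j. A (h i) (h j))"
    unfolding sdet_def
  proof (rule sum.cong[OF refl], clarify)
    fix p assume p: "p permutes S"
    have "(\<Prod>i\<in>T. A i (map_permutation S h p i)) = (\<Prod>i\<in>S. A (h i) (map_permutation S h p (h i)))"
      using h by (rule prod.reindex_bij_betw[symmetric])
    also have "\<dots> = (\<Prod>i\<in>S. A (h i) (h (p i)))"
      by (intro prod.cong refl) (simp add: map_permutation_apply[OF inj])
    finally show "of_int (sign (map_permutation S h p)) * (\<Prod>i\<in>T. A i (map_permutation S h p i))
        = of_int (sign p) * (\<Prod>i\<in>S. A (h i) (h (p i)))"
      by (simp add: sign_map_permutation[OF inj p S])
  qed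
  finally show ?thesis .
qed

lemma det_mat_eq_sdet: "det (mat n n (\<lambda>(i, j). A i j)) = sdet {0..<n} A"
proof -
  have "(\<Prod>i = 0..<n. mat n n (\<lambda>(i, j). A i j) $$ (i, p i)) = (\<Prod>i = 0..<n. A i (p i))"
    if "p permutes {0..<n}" for p
    using permutes_in_image[OF that] by (intro prod.cong refl) auto
  thus ?thesis by (simp add: det_def sdet_def)
qed

lemma sdet_eq_det:
  assumes "bij_betw h {0..<n} S"
  shows "sdet S A = det (mat n n (\<lambda>(i, j). A (h i) (h j)))"
  unfolding det_mat_eq_sdet using sdet_reindex[OF assms] by simp

lemma sdet_transpose:
  assumes "finite S"
  shows "sdet S (\<lambda>i j. A j i) = sdet S A"
proof -
  obtain h where h: "bij_betw h {0..<card S} S" using ex_bij_betw_nat_finite[OF assms] by blast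
  have "mat (card S) (card S) (\<lambda>(i, j). A (h j) (h i))
      = transpose_mat (mat (card S) (card S) (\<lambda>(i, j). A (h i) (h j)))"
    by (rule eq_matI) auto
  thus ?thesis
    by (simp add: sdet_eq_det[OF h] det_transpose[of _ "card S"])
qed

lemma sdet_mult:
  assumes "finite S"
  shows "sdet S A * sdet S B = sdet S (\<lambda>i j. \<Sum>k\<in>S. A i k * B k j)"
proof -
  obtain h where h: "bij_betw h {0..<card S} S" using ex_bij_betw_nat_finite[OF assms] by blast
  let ?n = "card S"
  have sum: "(\<Sum>k\<in>S. f k) = (\<Sum>k = 0..<?n. f (h k))" for f :: "_ \<Rightarrow> 'b"
    using sum.reindex_bij_betw[OF h] by metis
  have "mat ?n ?n (\<lambda>(i, j). \<Sum>k = 0..<?n. A (h i) (h k) * B (h k) (h j))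
     = mat ?n ?n (\<lambda>(i, j). A (h i) (h j)) * mat ?n ?n (\<lambda>(i, j). B (h i) (h j))"
    by (rule eq_matI) (auto simp: scalar_prod_def)
  thus ?thesis
    by (simp add: sdet_eq_det[OF h] sum det_mult[of _ ?n])
qed

lemma sdet_block_triangular:
  fixes A :: "'i \<Rightarrow> 'i \<Rightarrow> 'a::idom"
  assumes fin: "finite S" "finite T" and disj: "S \<inter> T = {}"
    and zero: "\<And>i j. i \<in> S \<Longrightarrow> j \<in> T \<Longrightarrow> A i j = 0"
  shows "sdet (S \<union> T) A = sdet S A * sdet T A"
proof -
  obtain h1 where h1: "bij_betw h1 {0..<card S} S" using ex_bij_betw_nat_finite[OF fin(1)] by blast
  obtain h2 where h2: "bij_betw h2 {0..<card T} T" using ex_bij_betw_nat_finite[OF fin(2)] by blast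
  define n k where "n = card S" and "k = card T"
  \<comment> \<open>The enumeration lists \<open>S\<close> before \<open>T\<close>, which makes the
    vanishing block the upper right one.\<close>
  define h where "h i = (if i < n then h1 i else h2 (i - n))" for i
  have "bij_betw (h2 \<circ> (\<lambda>i. i - n)) {n..<n + k} T"
    by (rule bij_betw_trans[OF _ h2[folded k_def]])
      (rule bij_betw_byWitness[where f' = "\<lambda>i. i + n"], auto)
  hence "bij_betw h {n..<n + k} T"
    by (rule bij_betw_cong[THEN iffD1, rotated]) (auto simp: h_def)
  moreover have "bij_betw h {0..<n} S"
    using h1[folded n_def] by (rule bij_betw_cong[THEN iffD1, rotated]) (auto simp: h_def)
  ultimately have "bij_betw h ({0..<n} \<union> {n..<n + k}) (S \<union> T)"
    using disj by (intro bij_betw_combine)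
  hence h: "bij_betw h {0..<n + k} (S \<union> T)" by (simp add: ivl_disj_un_two(3))
  have h1S: "h1 i \<in> S" if "i < n" for i using bij_betw_apply[OF h1] that by (simp add: n_def)
  have h2T: "h2 i \<in> T" if "i < k" for i using bij_betw_apply[OF h2] that by (simp add: k_def)
  have "mat (n + k) (n + k) (\<lambda>(i, j). A (h i) (h j)) =
    four_block_mat (mat n n (\<lambda>(i, j). A (h1 i) (h1 j))) (0\<^sub>m n k)
      (mat k n (\<lambda>(i, j). A (h2 i) (h1 j))) (mat k k (\<lambda>(i, j). A (h2 i) (h2 j)))"
    by (rule eq_matI) (auto simp: h_def zero h1S h2T)
  hence "sdet (S \<union> T) A = det (mat n n (\<lambda>(i, j). A (h1 i) (h1 j))) * det (mat k k (\<lambda>(i, j). A (h2 i) (h2 j)))"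
    by (simp add: sdet_eq_det[OF h] det_four_block_mat_upper_right_zero[of _ n _ k])
  also have "\<dots> = sdet S A * sdet T A"
    by (simp add: sdet_eq_det[OF h1[folded n_def]] sdet_eq_det[OF h2[folded k_def]])
  finally show ?thesis .
qed

lemma sdet_diagonal:
  fixes A :: "'i \<Rightarrow> 'i \<Rightarrow> 'a::idom"
  assumes "finite S" "\<And>i j. i \<in> S \<Longrightarrow> j \<in> S \<Longrightarrow> i \<noteq> j \<Longrightarrow> A i j = 0"
  shows "sdet S A = (\<Prod>i\<in>S. A i i)"
  using assms
proof (induction S)
  case (insert x S)
  have "sdet ({x} \<union> S) A = sdet {x} A * sdet S A"
    using insert.hyps insert.prems by (intro sdet_block_triangular) auto
  thus ?case using insert by simp
qed simp

text \<open>The shape of a block circulant matrix after Fourier transform; one block is split off at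
  a time.\<close>

lemma sdet_block_diagonal:
  fixes B :: "'b \<Rightarrow> 'i \<Rightarrow> 'i \<Rightarrow> 'a::idom"
  assumes I: "finite I" and J: "finite J"
  shows "sdet (I \<times> J) (\<lambda>x y. if snd x = snd y then B (snd x) (fst x) (fst y) else 0)
    = (\<Prod>b\<in>J. sdet I (B b))"
  using J
proof (induction J)
  case (insert c J)
  let ?A = "\<lambda>x y. if snd x = snd y then B (snd x) (fst x) (fst y) else 0"
  have "I \<times> insert c J = I \<times> {c} \<union> I \<times> J" by auto
  hence "sdet (I \<times> insert c J) ?A = sdet (I \<times> {c}) ?A * sdet (I \<times> J) ?A"
    using insert.hyps I by (simp only:) (intro sdet_block_triangular; auto)
  moreover have "sdet (I \<times> {c}) ?A = sdet I (B c)"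
  proof -
    have "bij_betw (\<lambda>i. (i, c)) I (I \<times> {c})"
      by (rule bij_betw_byWitness[where f' = fst]) auto
    from sdet_reindex[OF this I, of ?A] show ?thesis by simp
  qed
  ultimately show ?case using insert by simp
qed simp

text \<open>The all-ones vector lies in the kernel.\<close>

lemma sdet_zero_row_sums:
  fixes A :: "'i \<Rightarrow> 'i \<Rightarrow> 'a::idom"
  assumes fin: "finite S" and ne: "S \<noteq> {}" and row: "\<And>i. i \<in> S \<Longrightarrow> (\<Sum>j\<in>S. A i j) = 0"
  shows "sdet S A = 0"
proof -
  define n where "n = card S"
  obtain h where h: "bij_betw h {0..<n} S" using ex_bij_betw_nat_finite[OF fin] by (auto simp: n_def)
  let ?M = "mat n n (\<lambda>(i, j). A (h i) (h j))" and ?v = "vec n (\<lambda>_. 1 :: 'a)"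
  have "n > 0" using fin ne by (simp add: n_def card_gt_0_iff)
  hence "?v \<noteq> 0\<^sub>v n" by (metis index_vec index_zero_vec(1) one_neq_zero)
  moreover have "?M *\<^sub>v ?v = 0\<^sub>v n"
  proof (rule eq_vecI)
    fix i assume "i < dim_vec (0\<^sub>v n :: 'a vec)"
    hence i: "i < n" by simp
    have "(\<Sum>j = 0..<n. A (h i) (h j)) = (\<Sum>j\<in>S. A (h i) j)"
      using h by (rule sum.reindex_bij_betw)
    also have "\<dots> = 0" using row bij_betw_apply[OF h, of i] i by simp
    finally show "(?M *\<^sub>v ?v) $ i = 0\<^sub>v n $ i" using i by (simp add: scalar_prod_def)
  qed simp
  ultimately have "det ?M = 0"
    by (subst det_0_iff_vec_prod_zero[of _ n]) (auto intro!: exI[of _ ?v])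
  thus ?thesis by (simp add: sdet_eq_det[OF h])
qed

text \<open>A determinant is affine in each entry, with the complementary minor as slope: only
  permutations fixing \<open>v\<close> see the change. This is the counterpart of
  \<open>forest_count_delete_edge\<close>.\<close>

lemma sdet_diagonal_Suc:
  assumes fin: "finite S" and v: "v \<in> S"
    and vv: "A v v = B v v + 1"
    and eq: "\<And>i j. i \<in> S \<Longrightarrow> j \<in> S \<Longrightarrow> (i, j) \<noteq> (v, v) \<Longrightarrow> A i j = B i j"
  shows "sdet S A = sdet S B + sdet (S - {v}) A"
proof -
  let ?g = "\<lambda>p. of_int (sign p) * (\<Prod>i\<in>S - {v}. A i (p i))"
  have finP: "finite {p. p permutes S}" using fin by (rule finite_permutations)
  have split: "(\<Prod>i\<in>S. C i (p i)) = C v (p v) * (\<Prod>i\<in>S - {v}. C i (p i))" for C p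
    using fin v by (simp add: prod.remove)
  have summand: "of_int (sign p) * (\<Prod>i\<in>S. A i (p i))
      = of_int (sign p) * (\<Prod>i\<in>S. B i (p i)) + (if p v = v then ?g p else 0)"
    if p: "p permutes S" for p
  proof -
    have "(\<Prod>i\<in>S - {v}. A i (p i)) = (\<Prod>i\<in>S - {v}. B i (p i))"
      using permutes_in_image[OF p] by (intro prod.cong refl eq) auto
    moreover have "p v \<in> S" using permutes_in_image[OF p] v by simp
    ultimately show ?thesis using vv eq[of v "p v"] v
      by (auto simp: split[of A] split[of B] algebra_simps)
  qed
  have set: "{p \<in> {p. p permutes S}. p v = v} = {p. p permutes S - {v}}"
  proof (intro equalityI subsetI CollectI)
    fix p assume "p \<in> {p \<in> {p. p permutes S}. p v = v}"
    thus "p permutes S - {v}" by (auto intro: permutes_superset)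
  next
    fix p assume "p \<in> {p. p permutes S - {v}}"
    hence p: "p permutes S - {v}" by simp
    hence "p permutes S" by (rule permutes_subset) auto
    moreover have "p v = v" using p by (rule permutes_not_in) simp
    ultimately show "p \<in> {p. p permutes S} \<and> p v = v" by simp
  qed
  have "sdet S A = sdet S B + (\<Sum>p | p permutes S. if p v = v then ?g p else 0)"
    unfolding sdet_def by (simp add: summand sum.distrib)
  also have "(\<Sum>p | p permutes S. if p v = v then ?g p else 0) = sdet (S - {v}) A"
    unfolding sdet_def set[symmetric] using finP by (simp only: sum.inter_filter)
  finally show ?thesis .
qed

lemma sdet_hom:
  assumes "h 0 = 0" "h 1 = 1" "\<And>x y. h (x + y) = h x + h y" "\<And>x y. h (x * y) = h x * h y"
    "\<And>x. h (- x) = - h x"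
  shows "h (sdet S A) = sdet S (\<lambda>i j. h (A i j))"
proof -
  have sum: "h (sum f T) = (\<Sum>x\<in>T. h (f x))" for f :: "_ \<Rightarrow> 'b" and T :: "('c \<Rightarrow> 'c) set"
    by (induction T rule: infinite_finite_induct) (auto simp: assms)
  have prod: "h (prod f T) = (\<Prod>x\<in>T. h (f x))" for f :: "'c \<Rightarrow> 'b" and T
    by (induction T rule: infinite_finite_induct) (auto simp: assms)
  have "h (of_int (sign p)) = of_int (sign p)" for p :: "'c \<Rightarrow> 'c"
    by (simp add: sign_def assms)
  thus ?thesis by (simp add: sdet_def sum prod assms)
qed

section \<open>Rooted spanning forests\<close>

text \<open>Walks with explicit endpoints, the empty one included, so that induction and splitting
  along \<open>@\<close> work.\<close>

fun chain :: "('e \<Rightarrow> 'v) \<Rightarrow> ('e \<Rightarrow> 'v) \<Rightarrow> 'v \<Rightarrow> 'e list \<Rightarrow> 'v \<Rightarrow> bool" where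
  "chain src tgt x [] y \<longleftrightarrow> x = y"
| "chain src tgt x (e # es) y \<longleftrightarrow> src e = x \<and> chain src tgt (tgt e) es y"

lemma chain_append:
  "chain src tgt x (as @ bs) y \<longleftrightarrow> (\<exists>z. chain src tgt x as z \<and> chain src tgt z bs y)"
  by (induction as arbitrary: x) auto

lemma is_walk_iff_chain:
  "is_walk S src tgt es \<longleftrightarrow> es \<noteq> [] \<and> set es \<subseteq> S \<and> chain src tgt (src (hd es)) es (tgt (last es))"
proof -
  have *: "(\<forall>i. P i) \<longleftrightarrow> P 0 \<and> (\<forall>i. P (Suc i))" for P :: "nat \<Rightarrow> bool"
    by (metis not0_implies_Suc)
  have "es \<noteq> [] \<Longrightarrow> (\<forall>i. Suc i < length es \<longrightarrow> tgt (es ! i) = src (es ! Suc i))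
    \<longleftrightarrow> chain src tgt (src (hd es)) es (tgt (last es))"
  proof (induction es)
    case (Cons e es)
    show ?case
    proof (cases es)
      case (Cons e' es')
      have "(\<forall>i. Suc i < length (e # es) \<longrightarrow> tgt ((e # es) ! i) = src ((e # es) ! Suc i)) \<longleftrightarrow>
        tgt e = src e' \<and> (\<forall>i. Suc i < length es \<longrightarrow> tgt (es ! i) = src (es ! Suc i))"
        using Cons by (subst *) auto
      thus ?thesis using Cons.IH Cons by auto
    qed simp
  qed simp
  thus ?thesis by (auto simp: is_walk_def)
qed

lemma edges_distinct_Cons:
  "edges_distinct rv (e # es) \<longleftrightarrow> (\<forall>e'\<in>set es. e' \<noteq> e \<and> e' \<noteq> rv e) \<and> edges_distinct rv es"
proof -
  have "edges_distinct rv (e # es) \<longleftrightarrow> (\<forall>j<length es. es ! j \<noteq> e \<and> es ! j \<noteq> rv e) \<and> edges_distinct rv es"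
    unfolding edges_distinct_def
  proof (intro iffI conjI allI impI)
    fix i j
    assume *: "\<forall>i j. i < j \<longrightarrow> j < length (e # es) \<longrightarrow>
      (e # es) ! j \<noteq> (e # es) ! i \<and> (e # es) ! j \<noteq> rv ((e # es) ! i)"
    show "es ! j \<noteq> e" "es ! j \<noteq> rv e" if "j < length es"
      using *[rule_format, of 0 "Suc j"] that by auto
    show "es ! j \<noteq> es ! i" "es ! j \<noteq> rv (es ! i)" if "i < j" "j < length es"
      using *[rule_format, of "Suc i" "Suc j"] that by auto
  next
    fix i j
    assume *: "(\<forall>j<length es. es ! j \<noteq> e \<and> es ! j \<noteq> rv e) \<and>
      (\<forall>i j. i < j \<longrightarrow> j < length es \<longrightarrow> es ! j \<noteq> es ! i \<and> es ! j \<noteq> rv (es ! i))"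
      and "i < j" "j < length (e # es)"
    thus "(e # es) ! j \<noteq> (e # es) ! i" "(e # es) ! j \<noteq> rv ((e # es) ! i)"
      by (cases i; cases j; auto)+
  qed
  thus ?thesis by (auto simp: all_set_conv_all_nth)
qed

lemma chain_imp_rtrancl:
  assumes "chain src tgt x es y" "set es \<subseteq> T"
  shows "(x, y) \<in> (edge_rel T src tgt)\<^sup>*"
  using assms
proof (induction es arbitrary: x)
  case (Cons e es)
  hence "(x, tgt e) \<in> edge_rel T src tgt" by (auto simp: edge_rel_def)
  with Cons show ?case by (auto intro: converse_rtrancl_into_rtrancl)
qed simp

text \<open>When a new first vertex \<open>x\<close> already occurs on the chain, everything before
  that occurrence is dropped. Distinct vertices are what later yields distinct edges.\<close>

lemma rtrancl_imp_simple_chain: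
  assumes "(x, y) \<in> (edge_rel T src tgt)\<^sup>*"
  shows "\<exists>es. chain src tgt x es y \<and> set es \<subseteq> T \<and> distinct (map src es) \<and> y \<notin> src ` set es"
  using assms
proof (induction rule: converse_rtrancl_induct)
  case base
  show ?case by (rule exI[of _ "[]"]) simp
next
  case (step x z)
  then obtain e es where e: "e \<in> T" "src e = x" "tgt e = z"
    and es: "chain src tgt z es y" "set es \<subseteq> T" "distinct (map src es)" "y \<notin> src ` set es"
    by (auto simp: edge_rel_def)
  consider "x = y" | "x \<noteq> y" "x \<in> src ` set es" | "x \<noteq> y" "x \<notin> src ` set es" by blast
  thus ?case
  proof cases
    case 1
    thus ?thesis by (intro exI[of _ "[]"]) simp
  next
    case 2
    then obtain e' where e': "e' \<in> set es" "src e' = x" by blast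
    from split_list[OF e'(1)] obtain as bs where "es = as @ e' # bs" by blast
    thus ?thesis using es e' by (intro exI[of _ "e' # bs"]) (auto simp: chain_append)
  next
    case 3
    thus ?thesis using e es by (intro exI[of _ "e # es"]) auto
  qed
qed

lemma chain_tgt_mem:
  assumes "chain src tgt x es y" "e \<in> set es"
  shows "tgt e \<in> insert y (src ` set es)"
  using assms
proof (induction es arbitrary: x)
  case (Cons e' es)
  show ?case
  proof (cases "e = e'")
    case True
    thus ?thesis using Cons.prems by (cases es) auto
  next
    case False
    thus ?thesis using Cons by auto
  qed
qed simp

context
  fixes V :: "'v set" and E :: "'e set" and src tgt :: "'e \<Rightarrow> 'v" and rv :: "'e \<Rightarrow> 'e"
  assumes graph: "fin_graph V E src tgt rv"
begin

lemma fin_graph_simps: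
  assumes "e \<in> E"
  shows "src e \<in> V" "tgt e \<in> V" "rv e \<in> E" "rv e \<noteq> e" "rv (rv e) = e" "src (rv e) = tgt e" "tgt (rv e) = src e"
proof -
  show *: "src e \<in> V" "tgt e \<in> V" "rv e \<in> E" "rv e \<noteq> e" "rv (rv e) = e" "src (rv e) = tgt e"
    using graph assms by (auto simp: fin_graph_def)
  have "src (rv (rv e)) = tgt (rv e)" using graph * by (auto simp: fin_graph_def)
  with * show "tgt (rv e) = src e" by simp
qed

lemma finite_V: "finite V" and finite_E: "finite E"
  using graph by (auto simp: fin_graph_def)

lemma fin_graph_subset:
  assumes "S \<subseteq> E" "\<forall>e\<in>S. rv e \<in> S"
  shows "fin_graph V S src tgt rv"
  using assms graph by (auto simp: fin_graph_def intro: finite_subset)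

lemma delete_edge_closed:
  assumes "S \<subseteq> E" "\<forall>e\<in>S. rv e \<in> S" "e \<in> E"
  shows "S - {e, rv e} \<subseteq> E" "\<forall>e'\<in>S - {e, rv e}. rv e' \<in> S - {e, rv e}"
proof -
  show "\<forall>e'\<in>S - {e, rv e}. rv e' \<in> S - {e, rv e}"
  proof
    fix e' assume e': "e' \<in> S - {e, rv e}"
    hence "rv (rv e') = e'" using assms(1) fin_graph_simps(5)[of e'] by blast
    hence "rv e' \<noteq> e" "rv e' \<noteq> rv e" using e' fin_graph_simps(5)[OF assms(3)] by auto
    thus "rv e' \<in> S - {e, rv e}" using e' assms(2) by blast
  qed
qed (use assms in auto)

lemma edge_rel_sym:
  assumes "S \<subseteq> E" "\<forall>e\<in>S. rv e \<in> S" "(x, y) \<in> (edge_rel S src tgt)\<^sup>*"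
  shows "(y, x) \<in> (edge_rel S src tgt)\<^sup>*"
proof -
  have "sym (edge_rel S src tgt)"
  proof (rule symI)
    fix a b assume "(a, b) \<in> edge_rel S src tgt"
    then obtain e where "e \<in> S" "a = src e" "b = tgt e" by (auto simp: edge_rel_def)
    moreover from this have "src (rv e) = b" "tgt (rv e) = a" "rv e \<in> S"
      using assms fin_graph_simps[of e] by auto
    ultimately show "(b, a) \<in> edge_rel S src tgt" by (force simp: edge_rel_def)
  qed
  thus ?thesis using assms(3) by (metis sym_rtrancl symD)
qed

text \<open>A later edge ends at a later source or at \<open>y\<close>, and neither equals
  \<open>src e\<close>; hence the reverse of \<open>e\<close> cannot occur after
  \<open>e\<close>.\<close>

lemma edges_distinct_simple_chain:
  assumes "chain src tgt x es y" "set es \<subseteq> E" "distinct (map src es)" "y \<notin> src ` set es"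
  shows "edges_distinct rv es"
  using assms
proof (induction es arbitrary: x)
  case (Cons e es)
  have "e' \<noteq> e \<and> e' \<noteq> rv e" if e': "e' \<in> set es" for e'
  proof
    show "e' \<noteq> e" using Cons.prems e' by auto
    have "tgt e' \<in> insert y (src ` set es)"
      using chain_tgt_mem[of src tgt "tgt e" es y e'] Cons.prems(1) e' by simp
    moreover have "src e \<notin> insert y (src ` set es)" using Cons.prems by auto
    ultimately have "tgt e' \<noteq> src e" by metis
    thus "e' \<noteq> rv e" using fin_graph_simps(7)[of e] Cons.prems by auto
  qed
  thus ?case using Cons by (auto simp: edges_distinct_Cons)
qed (simp add: edges_distinct_def)

text \<open>Acyclicity becomes "every edge is a bridge", which is easier to follow under insertion
  and deletion of edges. The rest of a cycle bypasses its first edge; conversely a simple chain that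
  bypasses \<open>e\<close> is closed up by \<open>e\<close>. A loop is bypassed by the empty
  chain.\<close>

lemma has_cycle_iff_non_bridge:
  assumes S: "S \<subseteq> E" "\<forall>e\<in>S. rv e \<in> S"
  shows "has_cycle S src tgt rv \<longleftrightarrow> (\<exists>e\<in>S. (src e, tgt e) \<in> (edge_rel (S - {e, rv e}) src tgt)\<^sup>*)"
proof -
  have closed: "S - {e, rv e} \<subseteq> E" "\<forall>e'\<in>S - {e, rv e}. rv e' \<in> S - {e, rv e}" if "e \<in> S" for e
    using delete_edge_closed[OF S, of e] S(1) that by blast+
  show ?thesis
  proof
    assume "has_cycle S src tgt rv"
    then obtain es where es: "is_walk S src tgt es" "src (hd es) = tgt (last es)" "edges_distinct rv es"
      by (auto simp: has_cycle_def)
    then obtain e bs where ebs: "es = e # bs" by (cases es) (auto simp: is_walk_def)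
    have "chain src tgt (tgt e) bs (src e)" "set bs \<subseteq> S - {e, rv e}" "e \<in> S"
      using es by (auto simp: is_walk_iff_chain ebs edges_distinct_Cons)
    thus "\<exists>e\<in>S. (src e, tgt e) \<in> (edge_rel (S - {e, rv e}) src tgt)\<^sup>*"
      using edge_rel_sym[OF closed, of e] chain_imp_rtrancl by metis
  next
    assume "\<exists>e\<in>S. (src e, tgt e) \<in> (edge_rel (S - {e, rv e}) src tgt)\<^sup>*"
    then obtain e where e: "e \<in> S" "(src e, tgt e) \<in> (edge_rel (S - {e, rv e}) src tgt)\<^sup>*" by blast
    hence "(tgt e, src e) \<in> (edge_rel (S - {e, rv e}) src tgt)\<^sup>*"
      using edge_rel_sym[OF closed, of e] by blast
    then obtain es where es: "chain src tgt (tgt e) es (src e)" "set es \<subseteq> S - {e, rv e}"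
      "distinct (map src es)" "src e \<notin> src ` set es"
      using rtrancl_imp_simple_chain by metis
    have "set es \<subseteq> E" using es(2) S by auto
    hence "edges_distinct rv (e # es)"
      using edges_distinct_simple_chain[OF es(1) _ es(3,4)] es(2) by (auto simp: edges_distinct_Cons)
    moreover have last: "tgt (last (e # es)) = src e"
      using es(1) by (cases es rule: rev_cases) (auto simp: chain_append)
    moreover have "is_walk S src tgt (e # es)"
      unfolding is_walk_iff_chain last using e es by auto
    ultimately show "has_cycle S src tgt rv" unfolding has_cycle_def by (metis list.sel(1))
  qed
qed

lemma rooted_spanning_forest_iff:
  "rooted_spanning_forest V E src tgt rv R S \<longleftrightarrow> S \<subseteq> E \<and> (\<forall>e\<in>S. rv e \<in> S) \<and>
     (\<forall>e\<in>S. (src e, tgt e) \<notin> (edge_rel (S - {e, rv e}) src tgt)\<^sup>*) \<and>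
     (\<forall>v\<in>V. \<exists>!r. r \<in> R \<and> (v, r) \<in> (edge_rel S src tgt)\<^sup>*)"
  using has_cycle_iff_non_bridge[of S] unfolding rooted_spanning_forest_def by blast

end

text \<open>Crossing the new edge back cancels an earlier crossing, so at most one crossing has to
  be recorded.\<close>

lemma rtrancl_insert_sym_edge:
  assumes "(x, y) \<in> (A \<union> {(v, r), (r, v)})\<^sup>*"
  shows "(x, y) \<in> A\<^sup>* \<or> (x, v) \<in> A\<^sup>* \<and> (r, y) \<in> A\<^sup>* \<or> (x, r) \<in> A\<^sup>* \<and> (v, y) \<in> A\<^sup>*"
  using assms
proof (induction rule: rtrancl_induct)
  case (step y z)
  from step(2) show ?case
  proof
    assume "(y, z) \<in> A"
    thus ?thesis using step(3) by (meson rtrancl.rtrancl_into_rtrancl)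
  next
    assume "(y, z) \<in> {(v, r), (r, v)}"
    thus ?thesis using step(3) by auto
  qed
qed simp

lemma edge_rel_Un: "edge_rel (S \<union> T) src tgt = edge_rel S src tgt \<union> edge_rel T src tgt"
  by (auto simp: edge_rel_def)

lemma edge_rel_mono: "S \<subseteq> T \<Longrightarrow> (edge_rel S src tgt)\<^sup>* \<subseteq> (edge_rel T src tgt)\<^sup>*"
  by (rule rtrancl_mono) (auto simp: edge_rel_def)

section \<open>Adding and deleting an edge that leads into a root\<close>

context
  fixes V :: "'v set" and E :: "'e set" and src tgt :: "'e \<Rightarrow> 'v" and rv :: "'e \<Rightarrow> 'e"
    and R :: "'v set" and e :: 'e
  assumes graph: "fin_graph V E src tgt rv" and R: "R \<subseteq> V"
    and e: "e \<in> E" "src e \<notin> R" "tgt e \<in> R"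
begin

lemma edge_rel_insert_edge:
  "edge_rel (S \<union> {e, rv e}) src tgt = edge_rel S src tgt \<union> {(src e, tgt e), (tgt e, src e)}"
proof -
  have "edge_rel {e, rv e} src tgt = {(src e, tgt e), (src (rv e), tgt (rv e))}"
    by (auto simp: edge_rel_def)
  thus ?thesis unfolding edge_rel_Un using fin_graph_simps(6,7)[OF graph e(1)] by simp
qed

text \<open>The endpoints of \<open>e\<close> are two different roots, so \<open>e\<close> joins two
  different trees; the merged tree keeps the root \<open>tgt e\<close>.\<close>

lemma forest_insert_edge:
  assumes "rooted_spanning_forest V E src tgt rv (insert (src e) R) S"
  shows "e \<notin> S" "rv e \<notin> S" "rooted_spanning_forest V E src tgt rv R (S \<union> {e, rv e})"
proof -
  let ?A = "edge_rel S src tgt" and ?v = "src e" and ?r = "tgt e"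
  note ge = fin_graph_simps[OF graph e(1)]
  from assms have S: "S \<subseteq> E" "\<forall>e\<in>S. rv e \<in> S"
    and bridge: "\<And>e'. e' \<in> S \<Longrightarrow> (src e', tgt e') \<notin> (edge_rel (S - {e', rv e'}) src tgt)\<^sup>*"
    and root: "\<And>u. u \<in> V \<Longrightarrow> \<exists>!r. r \<in> insert ?v R \<and> (u, r) \<in> ?A\<^sup>*"
    unfolding rooted_spanning_forest_iff[OF graph] by auto
  note sym = edge_rel_sym[OF graph S]
  \<comment> \<open>\<open>src e\<close> is the one root of its own tree, which therefore contains
    no element of \<open>R\<close>.\<close>
  have vR: "(?v, r') \<notin> ?A\<^sup>*" if "r' \<in> R" for r'
    using root[OF ge(1)] e(2) that by (metis insertCI rtrancl.rtrancl_refl)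
  show eS: "e \<notin> S" using vR[OF e(3)] by (auto simp: edge_rel_def)
  show rS: "rv e \<notin> S" using S eS ge(5) by auto
  let ?S = "S \<union> {e, rv e}"
  have bridge': "(src e', tgt e') \<notin> (edge_rel (?S - {e', rv e'}) src tgt)\<^sup>*" if e': "e' \<in> ?S" for e'
  proof (cases "e' \<in> S")
    case True
    let ?B = "edge_rel (S - {e', rv e'}) src tgt"
    have "rv e' \<in> S" using True S by blast
    hence eq: "?S - {e', rv e'} = (S - {e', rv e'}) \<union> {e, rv e}" using True eS rS by auto
    have BA: "?B\<^sup>* \<subseteq> ?A\<^sup>*" by (rule edge_rel_mono) auto
    have ee: "(src e', tgt e') \<in> ?A\<^sup>*" using True by (auto simp: edge_rel_def)
    show ?thesis
    proof
      assume "(src e', tgt e') \<in> (edge_rel (?S - {e', rv e'}) src tgt)\<^sup>*"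
      hence "(src e', tgt e') \<in> ?B\<^sup>* \<or> (src e', ?v) \<in> ?B\<^sup>* \<and> (?r, tgt e') \<in> ?B\<^sup>*
        \<or> (src e', ?r) \<in> ?B\<^sup>* \<and> (?v, tgt e') \<in> ?B\<^sup>*"
        unfolding eq edge_rel_insert_edge by (rule rtrancl_insert_sym_edge)
      \<comment> \<open>A bypass of \<open>e'\<close> within the old forest is excluded by
        \<open>bridge\<close>, so it crosses the new edge. Closing it up with \<open>e'\<close>
        itself would connect the ends of \<open>e\<close> in the old forest.\<close>
      with bridge[OF True] BA have "(src e', ?v) \<in> ?A\<^sup>* \<and> (?r, tgt e') \<in> ?A\<^sup>*
        \<or> (src e', ?r) \<in> ?A\<^sup>* \<and> (?v, tgt e') \<in> ?A\<^sup>*" by blast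
      hence "(?v, ?r) \<in> ?A\<^sup>*" using ee sym by (meson rtrancl_trans)
      thus False using vR e(3) by blast
    qed
  next
    case False
    hence "?S - {e', rv e'} = S" using e' eS rS ge(5) by auto
    moreover have "(src e', tgt e') = (?v, ?r) \<or> (src e', tgt e') = (?r, ?v)" using False e' ge by auto
    ultimately show ?thesis using vR[OF e(3)] sym by auto
  qed
  \<comment> \<open>A root is reached either inside an old tree or through the new edge from the
    tree of \<open>src e\<close>, and then it can only be \<open>tgt e\<close>.\<close>
  have reach: "(u, r') \<in> ?A\<^sup>* \<or> (u, ?v) \<in> ?A\<^sup>* \<and> r' = ?r"
    if "r' \<in> R" "(u, r') \<in> (edge_rel ?S src tgt)\<^sup>*" for u r'
  proof -
    have "(u, r') \<in> ?A\<^sup>* \<or> (u, ?v) \<in> ?A\<^sup>* \<and> (?r, r') \<in> ?A\<^sup>* \<or> (u, ?r) \<in> ?A\<^sup>* \<and> (?v, r') \<in> ?A\<^sup>*"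
      using that(2) unfolding edge_rel_insert_edge by (rule rtrancl_insert_sym_edge)
    moreover have "r' = ?r" if "(?r, r') \<in> ?A\<^sup>*"
      using root[OF ge(2)] that \<open>r' \<in> R\<close> e(3) by (metis insertCI rtrancl.rtrancl_refl)
    ultimately show ?thesis using vR[OF that(1)] by blast
  qed
  have "\<exists>!r'. r' \<in> R \<and> (u, r') \<in> (edge_rel ?S src tgt)\<^sup>*" if u: "u \<in> V" for u
  proof -
    have mono: "?A\<^sup>* \<subseteq> (edge_rel ?S src tgt)\<^sup>*" by (rule edge_rel_mono) auto
    have vr: "(?v, ?r) \<in> edge_rel ?S src tgt" by (auto simp: edge_rel_def)
    from root[OF u] obtain a where a: "a \<in> insert ?v R" "(u, a) \<in> ?A\<^sup>*"
      and uniq: "\<And>b. b \<in> insert ?v R \<Longrightarrow> (u, b) \<in> ?A\<^sup>* \<Longrightarrow> b = a" by blast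
    have "\<exists>r'. r' \<in> R \<and> (u, r') \<in> (edge_rel ?S src tgt)\<^sup>*"
    proof (cases "a = ?v")
      case True
      hence "(u, ?r) \<in> (edge_rel ?S src tgt)\<^sup>*"
        using a mono vr by (meson rtrancl.rtrancl_into_rtrancl subsetD)
      thus ?thesis using e(3) by blast
    qed (use a mono in blast)
    moreover have "r1 = r2" if "r1 \<in> R" "(u, r1) \<in> (edge_rel ?S src tgt)\<^sup>*"
      "r2 \<in> R" "(u, r2) \<in> (edge_rel ?S src tgt)\<^sup>*" for r1 r2
      using reach[OF that(1,2)] reach[OF that(3,4)] uniq that(1,3) e(2) by (metis insertCI)
    ultimately show ?thesis by blast
  qed
  moreover have "\<forall>e'\<in>?S. rv e' \<in> ?S" using S ge by auto
  ultimately show "rooted_spanning_forest V E src tgt rv R ?S"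
    unfolding rooted_spanning_forest_iff[OF graph] using S bridge' ge(3) e(1) by auto
qed

text \<open>Since \<open>e\<close> is a bridge, its tree falls into two parts: the one containing
  \<open>tgt e\<close> keeps its root, the other one receives \<open>src e\<close> as root.\<close>

lemma forest_delete_edge:
  assumes "rooted_spanning_forest V E src tgt rv R S" "e \<in> S"
  shows "rooted_spanning_forest V E src tgt rv (insert (src e) R) (S - {e, rv e})"
proof -
  let ?T = "S - {e, rv e}" and ?v = "src e" and ?r = "tgt e"
  let ?A = "edge_rel ?T src tgt"
  note ge = fin_graph_simps[OF graph e(1)]
  from assms have S: "S \<subseteq> E" "\<forall>e\<in>S. rv e \<in> S"
    and bridge: "\<And>e'. e' \<in> S \<Longrightarrow> (src e', tgt e') \<notin> (edge_rel (S - {e', rv e'}) src tgt)\<^sup>*"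
    and root: "\<And>u. u \<in> V \<Longrightarrow> \<exists>!r. r \<in> R \<and> (u, r) \<in> (edge_rel S src tgt)\<^sup>*"
    unfolding rooted_spanning_forest_iff[OF graph] by auto
  have T: "?T \<subseteq> E" "\<forall>e'\<in>?T. rv e' \<in> ?T"
    using delete_edge_closed[OF graph S e(1)] .
  note sym = edge_rel_sym[OF graph T]
  have mono: "?A\<^sup>* \<subseteq> (edge_rel S src tgt)\<^sup>*" by (rule edge_rel_mono) auto
  have vr: "(?v, ?r) \<in> (edge_rel S src tgt)\<^sup>*" using assms(2) by (auto simp: edge_rel_def)
  have ST: "S = ?T \<union> {e, rv e}" using assms(2) S by auto
  have bridge': "(src e', tgt e') \<notin> (edge_rel (?T - {e', rv e'}) src tgt)\<^sup>*" if "e' \<in> ?T" for e'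
  proof -
    have "(edge_rel (?T - {e', rv e'}) src tgt)\<^sup>* \<subseteq> (edge_rel (S - {e', rv e'}) src tgt)\<^sup>*"
      by (rule edge_rel_mono) auto
    thus ?thesis using bridge[of e'] that by auto
  qed
  \<comment> \<open>A root still connected with \<open>src e\<close> would have to be
    \<open>tgt e\<close>, the root of the original tree, and \<open>e\<close> would not be a
    bridge.\<close>
  have v_only: "r' \<notin> R" if "(u, ?v) \<in> ?A\<^sup>*" "(u, r') \<in> ?A\<^sup>*" for u r'
  proof
    assume "r' \<in> R"
    have vr': "(?v, r') \<in> ?A\<^sup>*" using that sym by (meson rtrancl_trans)
    hence "(?v, r') \<in> (edge_rel S src tgt)\<^sup>*" using mono by blast
    hence "r' = ?r" using root[OF ge(1)] vr \<open>r' \<in> R\<close> e(3) by blast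
    thus False using bridge[OF assms(2)] vr' by simp
  qed
  have "\<exists>!r'. r' \<in> insert ?v R \<and> (u, r') \<in> ?A\<^sup>*" if u: "u \<in> V" for u
  proof -
    from root[OF u] obtain a where a: "a \<in> R" "(u, a) \<in> (edge_rel S src tgt)\<^sup>*"
      and uniq: "\<And>b. b \<in> R \<Longrightarrow> (u, b) \<in> (edge_rel S src tgt)\<^sup>* \<Longrightarrow> b = a" by blast
    have "(u, a) \<in> (?A \<union> {(?v, ?r), (?r, ?v)})\<^sup>*"
      using a(2) unfolding edge_rel_insert_edge[symmetric] ST[symmetric] .
    from rtrancl_insert_sym_edge[OF this] have "\<exists>r'. r' \<in> insert ?v R \<and> (u, r') \<in> ?A\<^sup>*"
      using a(1) e(3) by blast
    moreover have "r1 = r2" if "r1 \<in> insert ?v R" "(u, r1) \<in> ?A\<^sup>*"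
      "r2 \<in> insert ?v R" "(u, r2) \<in> ?A\<^sup>*" for r1 r2
      using that v_only[of u] uniq mono by blast
    ultimately show ?thesis by blast
  qed
  thus ?thesis
    unfolding rooted_spanning_forest_iff[OF graph] using T bridge' by auto
qed

text \<open>Forests avoiding \<open>e\<close> are forests of the smaller graph. Those containing
  \<open>e\<close> correspond, on removing \<open>e\<close>, to the forests with
  \<open>src e\<close> as an additional root.\<close>

lemma forest_count_delete_edge:
  "forest_count V E src tgt rv R = forest_count V (E - {e, rv e}) src tgt rv R
     + forest_count V E src tgt rv (insert (src e) R)"
proof -
  let ?F = "rooted_spanning_forest V E src tgt rv R"
  let ?G = "rooted_spanning_forest V E src tgt rv (insert (src e) R)"
  let ?H = "rooted_spanning_forest V (E - {e, rv e}) src tgt rv R"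
  let ?i = "\<lambda>S. S \<union> {e, rv e}"
  have fin: "finite (Collect ?F)" "finite (Collect ?G)" "finite (Collect ?H)"
    using finite_E[OF graph]
    by (auto simp: rooted_spanning_forest_def intro!: finite_subset[of _ "Pow E"])
  have H: "?H S \<longleftrightarrow> ?F S \<and> e \<notin> S" for S
    using fin_graph_simps[OF graph e(1)] unfolding rooted_spanning_forest_def by auto
  have "Collect ?F = Collect ?H \<union> ?i ` Collect ?G"
  proof (intro equalityI subsetI)
    fix S assume "S \<in> Collect ?F"
    hence S: "?F S" by simp
    show "S \<in> Collect ?H \<union> ?i ` Collect ?G"
    proof (cases "e \<in> S")
      case True
      have "S = ?i (S - {e, rv e})" using True S by (auto simp: rooted_spanning_forest_def)
      thus ?thesis using forest_delete_edge[OF S True] by blast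
    qed (use S H in auto)
  qed (use H forest_insert_edge(3) in auto)
  moreover have "Collect ?H \<inter> ?i ` Collect ?G = {}" using H by auto
  moreover have "inj_on ?i (Collect ?G)"
  proof (rule inj_onI)
    fix S T assume "S \<in> Collect ?G" "T \<in> Collect ?G" "?i S = ?i T"
    moreover from this have "e \<notin> S" "rv e \<notin> S" "e \<notin> T" "rv e \<notin> T" using forest_insert_edge(1,2) by auto
    ultimately show "S = T" by auto
  qed
  ultimately show ?thesis
    unfolding forest_count_def using fin by (simp add: card_Un_disjoint card_image)
qed

end

section \<open>Extreme root sets and positivity of the forest count\<close>

text \<open>An edge of such a forest would join two roots of one tree, hence be a loop, which is a
  cycle; only the empty forest remains.\<close>

lemma forest_count_all_roots:
  assumes graph: "fin_graph V E src tgt rv"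
  shows "forest_count V E src tgt rv V = 1"
proof -
  have "rooted_spanning_forest V E src tgt rv V S \<longleftrightarrow> S = {}" for S
  proof
    assume S: "rooted_spanning_forest V E src tgt rv V S"
    show "S = {}"
    proof (rule ccontr)
      assume "S \<noteq> {}"
      then obtain e where e: "e \<in> S" by blast
      with S have "e \<in> E" by (auto simp: rooted_spanning_forest_def)
      note ge = fin_graph_simps[OF graph this]
      have "(src e, tgt e) \<in> (edge_rel S src tgt)\<^sup>*" using e by (auto simp: edge_rel_def)
      hence "src e = tgt e"
        using S ge unfolding rooted_spanning_forest_def by (metis rtrancl.rtrancl_refl)
      thus False using S e unfolding rooted_spanning_forest_iff[OF graph] by (metis rtrancl.rtrancl_refl)
    qed
  next
    assume "S = {}"
    moreover have "edge_rel {} src tgt = {}" by (simp add: edge_rel_def)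
    ultimately show "rooted_spanning_forest V E src tgt rv V S"
      unfolding rooted_spanning_forest_iff[OF graph] by auto
  qed
  thus ?thesis by (simp add: forest_count_def)
qed

lemma exists_edge_into:
  assumes graph: "fin_graph V E src tgt rv" and S: "S \<subseteq> E"
    and u: "u \<in> V - R" "(u, r) \<in> (edge_rel S src tgt)\<^sup>*" "r \<in> R"
  shows "\<exists>e\<in>E. src e \<in> V - R \<and> tgt e \<in> R"
proof (rule ccontr)
  assume *: "\<not> ?thesis"
  have "r \<in> V - R" using u(2)
  proof (induction rule: rtrancl_induct)
    case (step y z)
    then obtain e where "e \<in> E" "src e = y" "tgt e = z" using S by (auto simp: edge_rel_def)
    thus ?case using * step fin_graph_simps[OF graph, of e] by auto
  qed (use u in auto)
  thus False using u(3) by simp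
qed

text \<open>Makes the valuations below meaningful. Connectedness supplies an edge into
  \<open>R\<close>, and the deletion recursion bounds the count below by the count with one more
  root.\<close>

lemma forest_count_pos:
  assumes graph: "fin_graph V E src tgt rv" and conn: "graph_connected V E src tgt"
    and R: "R \<subseteq> V" "R \<noteq> {}"
  shows "forest_count V E src tgt rv R > 0"
  using R
proof (induction "card (V - R)" arbitrary: R rule: less_induct)
  case less
  show ?case
  proof (cases "V - R = {}")
    case True
    hence "R = V" using less by auto
    thus ?thesis using forest_count_all_roots[OF graph] by simp
  next
    case False
    then obtain u r where u: "u \<in> V - R" and r: "r \<in> R" using less.prems by auto
    have "(u, r) \<in> (edge_rel E src tgt)\<^sup>*"
      using conn u r less.prems by (auto simp: graph_connected_def)
    from exists_edge_into[OF graph order.refl u this r]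
    obtain e where e: "e \<in> E" "src e \<in> V - R" "tgt e \<in> R" by blast
    have "card (V - insert (src e) R) < card (V - R)"
      using e finite_V[OF graph] by (intro psubset_card_mono) auto
    from less.hyps[OF this] have "forest_count V E src tgt rv (insert (src e) R) > 0"
      using less.prems e by auto
    moreover have "forest_count V E src tgt rv R = forest_count V (E - {e, rv e}) src tgt rv R
     + forest_count V E src tgt rv (insert (src e) R)"
      using e less.prems by (intro forest_count_delete_edge[OF graph]) auto
    ultimately show ?thesis by simp
  qed
qed

section \<open>The matrix-forest theorem\<close>

text \<open>Directed edges are counted, so in a graph with reversal a loop adds 2 to the degree and
  2 to the subtracted term, and cancels.\<close>

definition laplacian :: "'e set \<Rightarrow> ('e \<Rightarrow> 'v) \<Rightarrow> ('e \<Rightarrow> 'v) \<Rightarrow> 'v \<Rightarrow> 'v \<Rightarrow> int" where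
  "laplacian E src tgt x y = (if x = y then int (card {e\<in>E. src e = x}) else 0)
     - int (card {e\<in>E. src e = x \<and> tgt e = y})"

lemma sum_card_fibres:
  assumes "finite D" "finite W" "f ` D \<subseteq> W"
  shows "(\<Sum>y\<in>W. card {e\<in>D. f e = y}) = card D"
  using sum.group[OF assms, of "\<lambda>_. 1::nat"] by simp

text \<open>If some edge leads from outside \<open>R\<close> into \<open>R\<close>, both sides obey
  the same deletion recursion. Otherwise both are 1 when every vertex is a root, and both are 0 when
  not.\<close>

theorem matrix_forest:
  assumes "fin_graph V E src tgt rv" "R \<subseteq> V"
  shows "int (forest_count V E src tgt rv R) = sdet (V - R) (laplacian E src tgt)"
  using assms
proof (induction "card E + card (V - R)" arbitrary: E R rule: less_induct)
  case less
  note graph = less.prems(1) and R = less.prems(2)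
  note finV = finite_V[OF graph] and finE = finite_E[OF graph]
  show ?case
  proof (cases "\<exists>e\<in>E. src e \<in> V - R \<and> tgt e \<in> R")
    case True
    then obtain e where e: "e \<in> E" "src e \<in> V - R" "tgt e \<in> R" by blast
    note ge = fin_graph_simps[OF graph e(1)]
    let ?E = "E - {e, rv e}"
    have "\<forall>e'\<in>?E. rv e' \<in> ?E" using delete_edge_closed(2)[OF graph order.refl _ e(1)] fin_graph_simps(3)[OF graph] by blast
    hence graph': "fin_graph V ?E src tgt rv" by (intro fin_graph_subset[OF graph]) auto
    have "card ?E < card E" using e finE by (intro psubset_card_mono) auto
    hence IH1: "int (forest_count V ?E src tgt rv R) = sdet (V - R) (laplacian ?E src tgt)"
      using graph' R less.hyps[of ?E R] by simp
    have Vi: "V - insert (src e) R = V - R - {src e}" by auto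
    have "card (V - insert (src e) R) < card (V - R)"
      using e finV by (intro psubset_card_mono) auto
    hence "card E + card (V - insert (src e) R) < card E + card (V - R)" by simp
    from less.hyps[OF this graph] R e have IH2: "int (forest_count V E src tgt rv (insert (src e) R))
        = sdet (V - R - {src e}) (laplacian E src tgt)"
      by (simp add: Vi)
    \<comment> \<open>As \<open>tgt e\<close> is a root, deleting \<open>e\<close> and its reverse
      changes only the degree of \<open>src e\<close> among the entries indexed by
      \<open>V - R\<close>.\<close>
    have "sdet (V - R) (laplacian E src tgt) =
      sdet (V - R) (laplacian ?E src tgt) + sdet (V - R - {src e}) (laplacian E src tgt)"
    proof (rule sdet_diagonal_Suc)
      have "{e'\<in>E. src e' = src e} = insert e {e'\<in>?E. src e' = src e}" using e ge by auto
      hence "card {e'\<in>E. src e' = src e} = Suc (card {e'\<in>?E. src e' = src e})"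
        using finE by simp
      moreover have "{e'\<in>E. src e' = src e \<and> tgt e' = src e} = {e'\<in>?E. src e' = src e \<and> tgt e' = src e}"
        using e ge by auto
      ultimately show "laplacian E src tgt (src e) (src e) = laplacian ?E src tgt (src e) (src e) + 1"
        by (simp add: laplacian_def)
    next
      fix i j assume ij: "i \<in> V - R" "j \<in> V - R" "(i, j) \<noteq> (src e, src e)"
      have "{e'\<in>E. src e' = i \<and> tgt e' = j} = {e'\<in>?E. src e' = i \<and> tgt e' = j}"
        using e ge ij by auto
      moreover have "{e'\<in>E. src e' = i} = {e'\<in>?E. src e' = i}" if "i = j"
        using e ge ij that by auto
      ultimately show "laplacian E src tgt i j = laplacian ?E src tgt i j"
        by (simp add: laplacian_def)
    qed (use finV e in auto)
    moreover have "forest_count V E src tgt rv R = forest_count V ?E src tgt rv R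
       + forest_count V E src tgt rv (insert (src e) R)"
      using e R by (intro forest_count_delete_edge[OF graph]) auto
    ultimately show ?thesis using IH1 IH2 by simp
  next
    case no_edge: False
    show ?thesis
    proof (cases "V - R = {}")
      case True
      hence "R = V" using R by auto
      thus ?thesis using forest_count_all_roots[OF graph] by simp
    next
      case False
      then obtain u where u: "u \<in> V - R" by blast
      have "\<not> rooted_spanning_forest V E src tgt rv R S" for S
      proof
        assume S: "rooted_spanning_forest V E src tgt rv R S"
        then obtain r where "r \<in> R" "(u, r) \<in> (edge_rel S src tgt)\<^sup>*" "S \<subseteq> E"
          using u by (auto simp: rooted_spanning_forest_def)
        thus False using exists_edge_into[OF graph _ u] no_edge by blast
      qed
      hence "forest_count V E src tgt rv R = 0" by (simp add: forest_count_def)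
      \<comment> \<open>No edge leaves \<open>V - R\<close>, so each degree is used up by the
        entries of its row.\<close>
      moreover have "sdet (V - R) (laplacian E src tgt) = 0"
      proof (rule sdet_zero_row_sums)
        fix x assume x: "x \<in> V - R"
        let ?D = "{e\<in>E. src e = x}"
        have "tgt ` ?D \<subseteq> V - R" using no_edge x fin_graph_simps[OF graph] by auto
        hence "(\<Sum>y\<in>V - R. card {e\<in>?D. tgt e = y}) = card ?D"
          using finE finV by (intro sum_card_fibres) auto
        moreover have "{e\<in>?D. tgt e = y} = {e\<in>E. src e = x \<and> tgt e = y}" for y by auto
        ultimately have "(\<Sum>y\<in>V - R. card {e\<in>E. src e = x \<and> tgt e = y}) = card ?D" by simp
        hence "(\<Sum>y\<in>V - R. int (card {e\<in>E. src e = x \<and> tgt e = y})) = int (card ?D)"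
          unfolding of_nat_sum[symmetric] by simp
        thus "(\<Sum>y\<in>V - R. laplacian E src tgt x y) = 0"
          using x finV by (simp add: laplacian_def sum_subtractf)
      qed (use finV False in auto)
      ultimately show ?thesis by simp
    qed
  qed
qed

section \<open>Norms from \<open>\<int>[x]/(x^m - 1)\<close>\<close>

definition root_of_unity :: "nat \<Rightarrow> int \<Rightarrow> complex" where
  "root_of_unity m k = cis (2 * pi * of_int k / of_nat m)"

lemma root_of_unity_add: "root_of_unity m (a + b) = root_of_unity m a * root_of_unity m b"
  by (simp add: root_of_unity_def cis_mult distrib_left add_divide_distrib)

lemma root_of_unity_power: "root_of_unity m k ^ n = root_of_unity m (int n * k)"
  by (simp add: root_of_unity_def DeMoivre mult_ac)

lemma root_of_unity_eq_1_iff: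
  assumes "m > 0"
  shows "root_of_unity m k = 1 \<longleftrightarrow> int m dvd k"
proof
  assume "root_of_unity m k = 1"
  hence "cos (2 * pi * of_int k / of_nat m) = 1"
    by (simp add: root_of_unity_def complex_eq_iff)
  then obtain n :: int where "2 * pi * of_int k / of_nat m = of_int n * (2 * pi)"
    by (auto simp: cos_one_2pi_int)
  hence "(of_int k :: real) = of_int (n * int m)" using assms by (simp add: field_simps)
  hence "k = n * int m" by (simp only: of_int_eq_iff)
  thus "int m dvd k" by simp
next
  assume "int m dvd k"
  then obtain n where k: "k = int m * n" by blast
  have "2 * pi * of_int k / of_nat m = 2 * pi * (of_int n :: real)"
    using assms by (simp add: k)
  thus "root_of_unity m k = 1" by (simp add: root_of_unity_def)
qed

lemma root_of_unity_mod:
  assumes "m > 0"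
  shows "root_of_unity m (k mod int m) = root_of_unity m k"
proof -
  have "root_of_unity m k = root_of_unity m (k mod int m + int m * (k div int m))" by simp
  also have "\<dots> = root_of_unity m (k mod int m)"
    unfolding root_of_unity_add using root_of_unity_eq_1_iff[OF assms] by simp
  finally show ?thesis ..
qed

lemma root_of_unity_mod_mult:
  assumes "m > 0"
  shows "root_of_unity m (k mod int m * b) = root_of_unity m (k * b)"
proof -
  have "root_of_unity m (k mod int m * b) = root_of_unity m ((k mod int m * b) mod int m)"
    by (rule root_of_unity_mod[OF assms, symmetric])
  also have "\<dots> = root_of_unity m ((k * b) mod int m)" by (simp add: mod_mult_left_eq)
  finally show ?thesis by (simp add: root_of_unity_mod[OF assms])
qed

text \<open>Orthogonality of the characters of the cyclic group, by the geometric sum.\<close>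

lemma sum_root_of_unity:
  assumes "m > 0"
  shows "(\<Sum>c\<in>{0..<int m}. root_of_unity m (c * k)) = (if int m dvd k then of_nat m else 0)"
proof -
  let ?z = "root_of_unity m k"
  have "(\<Sum>c\<in>{0..<int m}. root_of_unity m (c * k)) = (\<Sum>i<m. ?z ^ i)"
    by (rule sum.reindex_bij_witness[of _ int nat]) (auto simp: root_of_unity_power)
  also have "\<dots> = (if int m dvd k then of_nat m else 0)"
  proof (cases "int m dvd k")
    case True
    hence "?z = 1" using assms by (simp add: root_of_unity_eq_1_iff)
    thus ?thesis using True by simp
  next
    case False
    hence "?z \<noteq> 1" using assms by (simp add: root_of_unity_eq_1_iff)
    moreover have "?z ^ m = 1" using assms by (simp add: root_of_unity_power root_of_unity_eq_1_iff)
    ultimately show ?thesis using False by (simp add: geometric_sum)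
  qed
  finally show ?thesis .
qed

text \<open>\<open>F\<close> is the Fourier matrix in the second coordinate and \<open>D\<close> is
  block diagonal with blocks \<open>G b\<close>. The hypothesis \<open>eigen\<close> says
  \<open>L F = F D\<close>, and \<open>F\<close> is invertible, so \<open>L\<close> and
  \<open>D\<close> have equal determinants.\<close>

lemma sdet_block_circulant:
  fixes L :: "'v \<times> int \<Rightarrow> 'v \<times> int \<Rightarrow> int" and G :: "int \<Rightarrow> 'v \<Rightarrow> 'v \<Rightarrow> complex"
  assumes U: "finite U" and m: "m > 0"
    and eigen: "\<And>v w a b. v \<in> U \<Longrightarrow> w \<in> U \<Longrightarrow> a \<in> {0..<int m} \<Longrightarrow> b \<in> {0..<int m} \<Longrightarrow>
      (\<Sum>c\<in>{0..<int m}. of_int (L (v, a) (w, c)) * root_of_unity m (c * b))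
        = root_of_unity m (a * b) * G b v w"
  shows "of_int (sdet (U \<times> {0..<int m}) L) = (\<Prod>b\<in>{0..<int m}. sdet U (G b))"
proof -
  let ?J = "{0..<int m}"
  let ?S = "U \<times> ?J"
  define F :: "'v \<times> int \<Rightarrow> 'v \<times> int \<Rightarrow> complex"
    where "F x y = (if fst x = fst y then root_of_unity m (snd x * snd y) else 0)" for x y
  define F' :: "'v \<times> int \<Rightarrow> 'v \<times> int \<Rightarrow> complex"
    where "F' x y = (if fst x = fst y then root_of_unity m (- (snd x * snd y)) else 0)" for x y
  define D :: "'v \<times> int \<Rightarrow> 'v \<times> int \<Rightarrow> complex"
    where "D x y = (if snd x = snd y then G (snd x) (fst x) (fst y) else 0)" for x y
  have S: "finite ?S" using U by simp
  have sum: "(\<Sum>k\<in>?S. g k) = (\<Sum>u\<in>U. \<Sum>c\<in>?J. g (u, c))" for g :: "_ \<Rightarrow> complex"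
    by (simp add: sum.cartesian_product)
  \<comment> \<open>By orthogonality \<open>F F'\<close> is \<open>m\<close> times the identity,
    whence \<open>F\<close> has nonzero determinant.\<close>
  have "sdet ?S F * sdet ?S F' = sdet ?S (\<lambda>x y. if x = y then of_nat m else 0)"
    unfolding sdet_mult[OF S]
  proof (rule sdet_cong)
    fix x y assume "x \<in> ?S" "y \<in> ?S"
    then obtain v a w b where xy: "x = (v, a)" "y = (w, b)" "v \<in> U" "w \<in> U" "a \<in> ?J" "b \<in> ?J" by auto
    have "(\<Sum>k\<in>?S. F x k * F' k y)
        = (\<Sum>u\<in>U. if u = v then if v = w then \<Sum>c\<in>?J. root_of_unity m (c * (a - b)) else 0 else 0)"
      unfolding sum by (intro sum.cong refl)
        (auto simp: F_def F'_def xy root_of_unity_add[symmetric] algebra_simps)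
    also have "\<dots> = (if v = w then if int m dvd a - b then of_nat m else 0 else 0)"
      using U xy by (simp add: sum.delta sum_root_of_unity[OF m])
    also have "int m dvd a - b \<longleftrightarrow> a = b"
      using xy by (auto simp: mod_eq_dvd_iff[symmetric])
    finally show "(\<Sum>k\<in>?S. F x k * F' k y) = (if x = y then of_nat m else 0)" by (simp add: xy)
  qed
  also have "\<dots> \<noteq> 0" using S m by (subst sdet_diagonal) auto
  finally have F0: "sdet ?S F \<noteq> 0" by auto
  \<comment> \<open>The entrywise form of \<open>L F = F D\<close>; Kronecker deltas are inserted to
    recognise the right-hand product.\<close>
  have "sdet ?S (\<lambda>x y. of_int (L x y)) * sdet ?S F = sdet ?S F * sdet ?S D"
    unfolding sdet_mult[OF S]
  proof (rule sdet_cong)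
    fix x y assume "x \<in> ?S" "y \<in> ?S"
    then obtain v a w b where xy: "x = (v, a)" "y = (w, b)" "v \<in> U" "w \<in> U" "a \<in> ?J" "b \<in> ?J" by auto
    have "(\<Sum>k\<in>?S. of_int (L x k) * F k y)
       = (\<Sum>u\<in>U. if u = w then \<Sum>c\<in>?J. of_int (L (v, a) (w, c)) * root_of_unity m (c * b) else 0)"
      unfolding sum by (intro sum.cong refl) (auto simp: F_def xy)
    also have "\<dots> = root_of_unity m (a * b) * G b v w"
      using U xy eigen[of v w a b] by (simp add: sum.delta)
    also have "\<dots> = (\<Sum>u\<in>U. if u = v then \<Sum>c\<in>?J. if c = b then root_of_unity m (a * c) * G c u w else 0 else 0)"
      using U xy by (simp add: sum.delta)
    also have "\<dots> = (\<Sum>u\<in>U. \<Sum>c\<in>?J. if u = v then if c = b then root_of_unity m (a * c) * G c u w else 0 else 0)"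
      by (intro sum.cong refl) simp
    also have "\<dots> = (\<Sum>k\<in>?S. F x k * D k y)"
      unfolding sum by (intro sum.cong refl) (simp add: F_def D_def xy)
    finally show "(\<Sum>k\<in>?S. of_int (L x k) * F k y) = (\<Sum>k\<in>?S. F x k * D k y)" .
  qed
  hence "sdet ?S (\<lambda>x y. of_int (L x y)) = sdet ?S D" using F0 by simp
  also have "\<dots> = (\<Prod>b\<in>?J. sdet U (G b))"
    unfolding D_def by (rule sdet_block_diagonal[OF U]) simp
  finally show ?thesis using sdet_hom[of "of_int :: int \<Rightarrow> complex" ?S L] by simp
qed

section \<open>Norms as products of values at roots of unity\<close>

definition ipoly :: "int poly \<Rightarrow> complex \<Rightarrow> complex" where
  "ipoly F z = poly (map_poly of_int F) z"

lemma ipoly_simps [simp]: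
  "ipoly (F + G) z = ipoly F z + ipoly G z"
  "ipoly (F - G) z = ipoly F z - ipoly G z"
  "ipoly (F * G) z = ipoly F z * ipoly G z"
  "ipoly (F ^ n) z = ipoly F z ^ n"
  "ipoly (- F) z = - ipoly F z"
  "ipoly 0 z = 0"
  "ipoly 1 z = 1"
  "ipoly [:a:] z = of_int a"
  "ipoly [:a, b:] z = of_int a + z * of_int b"
  "ipoly (smult a F) z = of_int a * ipoly F z"
  "ipoly (pcompose F G) z = ipoly F (ipoly G z)"
  by (simp_all add: ipoly_def hom_distribs poly_pcompose)

lemma ipoly_sum: "ipoly (sum F A) z = (\<Sum>x\<in>A. ipoly (F x) z)"
  by (induction A rule: infinite_finite_induct) auto

lemma ipoly_altdef: "ipoly F z = (\<Sum>k\<le>degree F. of_int (coeff F k) * z ^ k)"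
  by (simp add: ipoly_def poly_altdef)

text \<open>Matrix of multiplication by \<open>F\<close> on \<open>\<int>[x]/(x^m - 1)\<close>.\<close>
definition circulant :: "nat \<Rightarrow> int poly \<Rightarrow> int \<Rightarrow> int \<Rightarrow> int" where
  "circulant m F a b = (\<Sum>k\<le>degree F. if (a + int k) mod int m = b then coeff F k else 0)"

text \<open>With \<open>T = x - 1\<close>, the norm of \<open>F(T)\<close> from \<open>\<int>[x]/(x^m - 1)\<close> to \<open>\<int>\<close>.\<close>
definition cyclic_norm :: "nat \<Rightarrow> int poly \<Rightarrow> int" where
  "cyclic_norm m F = sdet {0..<int m} (circulant m (pcompose F [:-1, 1:]))"

lemma cyclic_norm_eq_prod:
  assumes m: "m > 0"
  shows "of_int (cyclic_norm m F) = (\<Prod>b\<in>{0..<int m}. ipoly F (root_of_unity m b - 1))"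
proof -
  let ?J = "{0..<int m}" and ?F = "pcompose F [:-1, 1:]"
  \<comment> \<open>A one-point first coordinate turns the circulant matrix into a block circulant
    one with blocks of size 1.\<close>
  define L :: "unit \<times> int \<Rightarrow> unit \<times> int \<Rightarrow> int" where "L x y = circulant m ?F (snd x) (snd y)" for x y
  have "bij_betw (\<lambda>a. ((), a)) ?J ({()} \<times> ?J)"
    by (rule bij_betw_byWitness[where f' = snd]) auto
  from sdet_reindex[OF this, of L] have "cyclic_norm m F = sdet ({()} \<times> ?J) L"
    by (simp add: cyclic_norm_def L_def)
  also have "of_int \<dots> = (\<Prod>b\<in>?J. sdet {()} (\<lambda>_ _. ipoly F (root_of_unity m b - 1)))"
  proof (rule sdet_block_circulant)
    fix v w :: unit and a b assume a: "a \<in> ?J" and b: "b \<in> ?J"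
    have "(\<Sum>c\<in>?J. of_int (L (v, a) (w, c)) * root_of_unity m (c * b)) =
      (\<Sum>c\<in>?J. \<Sum>k\<le>degree ?F. if (a + int k) mod int m = c then of_int (coeff ?F k) * root_of_unity m (c * b) else 0)"
      by (auto simp: L_def circulant_def sum_distrib_right intro!: sum.cong)
    also have "\<dots> = (\<Sum>k\<le>degree ?F. \<Sum>c\<in>?J. if (a + int k) mod int m = c then of_int (coeff ?F k) * root_of_unity m (c * b) else 0)"
      by (rule sum.swap)
    also have "\<dots> = (\<Sum>k\<le>degree ?F. of_int (coeff ?F k) * root_of_unity m ((a + int k) mod int m * b))"
      using m by (intro sum.cong refl) (simp add: sum.delta')
    also have "\<dots> = root_of_unity m (a * b) * ipoly ?F (root_of_unity m b)"
      unfolding root_of_unity_mod_mult[OF m] ipoly_altdef sum_distrib_left root_of_unity_power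
        distrib_right root_of_unity_add by (simp only: mult_ac)
    finally show "(\<Sum>c\<in>?J. of_int (L (v, a) (w, c)) * root_of_unity m (c * b))
        = root_of_unity m (a * b) * ipoly F (root_of_unity m b - 1)" by simp
  qed (use m in auto)
  also have "\<dots> = (\<Prod>b\<in>?J. ipoly F (root_of_unity m b - 1))"
    by simp
  finally show ?thesis .
qed

text \<open>The norm sees only the values at \<open>root_of_unity m b - 1\<close>, that is, the
  class modulo \<open>(1 + T)^m - 1\<close>.\<close>

lemma cyclic_norm_cong:
  assumes "m > 0" "\<And>b. b \<in> {0..<int m} \<Longrightarrow> ipoly F (root_of_unity m b - 1) = ipoly G (root_of_unity m b - 1)"
  shows "cyclic_norm m F = cyclic_norm m G"
proof -
  have "(of_int (cyclic_norm m F) :: complex) = of_int (cyclic_norm m G)"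
    unfolding cyclic_norm_eq_prod[OF assms(1)] using assms(2) by (rule prod.cong[OF refl])
  thus ?thesis by simp
qed

lemma cyclic_norm_mult:
  assumes "m > 0"
  shows "cyclic_norm m (F * G) = cyclic_norm m F * cyclic_norm m G"
proof -
  have "(of_int (cyclic_norm m (F * G)) :: complex) = of_int (cyclic_norm m F * cyclic_norm m G)"
    by (simp only: of_int_mult cyclic_norm_eq_prod[OF assms] ipoly_simps prod.distrib)
  thus ?thesis by (simp only: of_int_eq_iff)
qed

lemma cyclic_norm_const:
  assumes "m > 0"
  shows "cyclic_norm m [:c:] = c ^ m"
proof -
  have "(of_int (cyclic_norm m [:c:]) :: complex) = of_int (c ^ m)"
    by (simp add: cyclic_norm_eq_prod[OF assms])
  thus ?thesis by (simp only: of_int_eq_iff)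
qed

lemma circulant_bound:
  assumes "degree F \<le> N"
  shows "circulant m F a b = (\<Sum>k\<le>N. if (a + int k) mod int m = b then coeff F k else 0)"
  unfolding circulant_def using assms by (intro sum.mono_neutral_left) (auto simp: coeff_eq_0)

lemma sdet_cong_mod:
  fixes A B :: "'i \<Rightarrow> 'i \<Rightarrow> int"
  assumes "\<And>i j. i \<in> S \<Longrightarrow> j \<in> S \<Longrightarrow> [A i j = B i j] (mod c)"
  shows "[sdet S A = sdet S B] (mod c)"
  unfolding sdet_def
  by (intro cong_sum cong_mult cong_refl cong_prod) (auto simp: assms permutes_in_image)

text \<open>Here the definition by an integer determinant pays off: congruences between entries pass
  to the determinant, which the complex product does not show.\<close>

lemma cyclic_norm_cong_mod:
  assumes "[:c:] dvd F - G"
  shows "[cyclic_norm m F = cyclic_norm m G] (mod c)"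
proof -
  let ?F = "pcompose F [:-1, 1:]" and ?G = "pcompose G [:-1, 1:]"
  from assms obtain H where H: "F - G = [:c:] * H" by blast
  have "?F - ?G = [:c:] * pcompose H [:-1, 1:]"
    by (metis H pcompose_diff pcompose_mult pcompose_const)
  hence "[:c:] dvd ?F - ?G" by (rule dvdI)
  hence *: "[coeff ?F k = coeff ?G k] (mod c)" for k
    unfolding const_poly_dvd_iff by (simp add: cong_iff_dvd_diff)
  define N where "N = max (degree ?F) (degree ?G)"
  have "circulant m ?F a b = (\<Sum>k\<le>N. if (a + int k) mod int m = b then coeff ?F k else 0)"
       "circulant m ?G a b = (\<Sum>k\<le>N. if (a + int k) mod int m = b then coeff ?G k else 0)" for a b
    by (simp_all add: N_def circulant_bound)
  thus ?thesis
    unfolding cyclic_norm_def by (intro sdet_cong_mod) (auto intro!: cong_sum simp: *)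
qed

section \<open>Truncation of norms modulo powers of p\<close>

lemma prime_dvd_prime_power_choose:
  fixes p :: nat
  assumes p: "prime p" and k: "0 < k" "k < p ^ n"
  shows "p dvd (p ^ n choose k)"
proof (rule ccontr)
  assume "\<not> p dvd (p ^ n choose k)"
  hence "coprime (p ^ n) (p ^ n choose k)" using p by (simp add: prime_imp_coprime)
  moreover have "k * (p ^ n choose k) = p ^ n * ((p ^ n - 1) choose (k - 1))"
    using times_binomial_minus1_eq[of k "p ^ n"] k by simp
  hence "p ^ n dvd k * (p ^ n choose k)" by simp
  ultimately have "p ^ n dvd k" by (simp add: coprime_dvd_mult_left_iff)
  thus False using k by (auto dest: dvd_imp_le)
qed

text \<open>Frobenius modulo \<open>p\<close>. Where \<open>(1 + T)^(p^n) = 1\<close>, it makes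
  \<open>T^(p^n)\<close> a multiple of \<open>p\<close>.\<close>

lemma X_power_prime_power:
  assumes p: "prime p"
  shows "\<exists>s. monom 1 (p ^ n) = [:1, 1:] ^ (p ^ n) - 1 + [:int p:] * s"
proof -
  let ?N = "p ^ n"
  have N: "?N > 0" using p by (simp add: prime_gt_0_nat)
  have "int p dvd coeff (monom 1 ?N - ([:1, 1:] ^ ?N - 1)) k" for k
  proof -
    consider "k = 0" | "0 < k" "k < ?N" | "k = ?N" | "k > ?N" by linarith
    thus ?thesis
    proof cases
      case 4
      have "degree ([:1, 1::int:] ^ ?N) = ?N" by (simp add: degree_linear_power)
      with 4 show ?thesis by (simp add: coeff_eq_0)
    next
      case 2
      thus ?thesis using prime_dvd_prime_power_choose[OF p 2] by (simp add: coeff_linear_poly_power)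
    qed (use N in \<open>simp_all add: coeff_linear_poly_power\<close>)
  qed
  hence "[:int p:] dvd monom 1 ?N - ([:1, 1:] ^ ?N - 1)" unfolding const_poly_dvd_iff by blast
  then obtain s where "monom 1 ?N - ([:1, 1:] ^ ?N - 1) = [:int p:] * s" by blast
  hence "monom 1 ?N = [:1, 1:] ^ ?N - 1 + [:int p:] * s" by (simp add: algebra_simps)
  thus ?thesis by blast
qed

text \<open>At the points that matter \<open>T^(p^n)\<close> equals \<open>p s\<close>, so every
  term from \<open>T^(K p^n)\<close> on is divisible by \<open>p^K\<close>.\<close>

lemma cyclic_norm_truncate:
  assumes p: "prime p"
    and coeffs: "\<And>i. i < K * p ^ n \<Longrightarrow> int p ^ K dvd coeff F i - coeff G i"
  shows "[cyclic_norm (p ^ n) F = cyclic_norm (p ^ n) G] (mod int p ^ K)"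
proof -
  let ?N = "K * p ^ n" and ?m = "p ^ n"
  have m: "?m > 0" using p by (simp add: prime_gt_0_nat)
  obtain s where s: "monom 1 ?m = [:1, 1:] ^ ?m - 1 + [:int p:] * s"
    using X_power_prime_power[OF p] by blast
  define H where "H = F - G"
  have "[:int p ^ K:] dvd poly_cutoff ?N H"
    unfolding const_poly_dvd_iff using coeffs by (auto simp: coeff_poly_cutoff H_def)
  then obtain H1 where H1: "poly_cutoff ?N H = [:int p ^ K:] * H1" by blast
  \<comment> \<open>The difference is split into its low part, divisible by \<open>p^K\<close>, and
    a multiple of \<open>T^(K p^n)\<close>.\<close>
  have H: "H = [:int p ^ K:] * H1 + monom 1 ?m ^ K * poly_shift ?N H"
    unfolding H1[symmetric]
    by (rule poly_eqI)
      (auto simp: coeff_poly_cutoff coeff_monom_mult coeff_poly_shift monom_power mult.commute[of K])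
  \<comment> \<open>Replacing \<open>T^(K p^n)\<close> by \<open>p^K s^K\<close> in \<open>F\<close>
    keeps the norm exactly and leaves a polynomial congruent to \<open>G\<close> modulo
    \<open>p^K\<close>.\<close>
  define G' where "G' = G + [:int p ^ K:] * (H1 + s ^ K * poly_shift ?N H)"
  have "cyclic_norm ?m F = cyclic_norm ?m G'"
  proof (rule cyclic_norm_cong[OF m])
    fix b assume "b \<in> {0..<int ?m}"
    let ?z = "root_of_unity ?m b - 1"
    have "root_of_unity ?m b ^ ?m = 1"
      using m by (simp add: root_of_unity_power root_of_unity_eq_1_iff)
    hence "ipoly (monom 1 ?m) ?z = of_nat p * ipoly s ?z"
      unfolding s by simp
    moreover have "F = G + H" by (simp add: H_def)
    hence "ipoly F ?z = ipoly (G + ([:int p ^ K:] * H1 + monom 1 ?m ^ K * poly_shift ?N H)) ?z"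
      using H by metis
    ultimately show "ipoly F ?z = ipoly G' ?z"
      by (simp add: G'_def power_mult_distrib algebra_simps)
  qed
  also have "[\<dots> = cyclic_norm ?m G] (mod int p ^ K)"
    by (rule cyclic_norm_cong_mod) (unfold G'_def add_diff_cancel_left', rule dvd_triv_left)
  finally show ?thesis .
qed

text \<open>A contribution to \<open>T^i\<close> with \<open>i < N\<close> must take the constant
  term from at least one of the \<open>N\<close> factors.\<close>

lemma coeff_power_dvd:
  fixes y :: "'a::comm_ring_1 poly"
  assumes "q dvd coeff y 0" "i < N"
  shows "q dvd coeff (y ^ N) i"
  using assms(2)
proof (induction N arbitrary: i)
  case (Suc N)
  have "q dvd coeff y j * coeff (y ^ N) (i - j)" if "j \<le> i" for j
    using Suc assms(1) that by (cases j) auto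
  thus ?case by (auto simp: coeff_mult intro!: dvd_sum)
qed simp

text \<open>A finite geometric series inverts \<open>h\<close> modulo \<open>(p, T^(p^n))\<close>,
  and by truncation with \<open>K = 1\<close> this makes its norm invertible modulo
  \<open>p\<close>.\<close>

lemma cyclic_norm_unit:
  assumes p: "prime p" and h: "\<not> int p dvd coeff h 0"
  shows "\<not> int p dvd cyclic_norm (p ^ n) h"
proof
  let ?m = "p ^ n"
  assume dvd: "int p dvd cyclic_norm ?m h"
  have m: "?m > 0" using p by (simp add: prime_gt_0_nat)
  have "coprime (coeff h 0) (int p)"
    using p h prime_imp_coprime[of "int p" "coeff h 0"] by (simp add: coprime_commute)
  then obtain u where u: "[coeff h 0 * u = 1] (mod int p)"
    using cong_solve_coprime_int by blast
  \<comment> \<open>\<open>u\<close> inverts the constant term of \<open>h\<close> modulo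
    \<open>p\<close>, so the constant term of \<open>y\<close> is divisible by \<open>p\<close> and
    \<open>y^(p^n)\<close> vanishes modulo \<open>(p, T^(p^n))\<close>.\<close>
  define y where "y = 1 - h * [:u:]"
  have y0: "int p dvd coeff y 0"
    using u by (simp add: y_def cong_iff_dvd_diff dvd_diff_commute mult.commute)
  have "h * ([:u:] * (\<Sum>k<?m. y ^ k)) = 1 - y ^ ?m"
    using one_diff_power_eq[of y ?m] by (simp add: y_def mult_ac)
  hence "[cyclic_norm ?m (h * ([:u:] * (\<Sum>k<?m. y ^ k))) = cyclic_norm ?m [:1:]] (mod int p ^ 1)"
    by (intro cyclic_norm_truncate[OF p]) (auto simp: coeff_power_dvd[OF y0] one_pCons)
  hence "[cyclic_norm ?m h * cyclic_norm ?m ([:u:] * (\<Sum>k<?m. y ^ k)) = 1] (mod int p)"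
    by (simp only: cyclic_norm_mult[OF m] cyclic_norm_const[OF m] power_one power_one_right)
  hence "int p dvd 1" using dvd by (meson cong_dvd_iff dvd_mult2)
  thus False using p by auto
qed

section \<open>Norms of distinguished polynomials\<close>

text \<open>For \<open>p\<close> prime and \<open>q = p^n\<close> these exponents give the roots of
  unity of exact order \<open>p^(n+1)\<close>.\<close>

definition primitive_exponents :: "nat \<Rightarrow> nat \<Rightarrow> int set" where
  "primitive_exponents p q = {b\<in>{0..<int (p * q)}. \<not> int p dvd b}"

text \<open>The part of the norm that is new at order \<open>p q\<close>. It is kept as a complex
  number; integers reappear after multiplication by norms of order \<open>q\<close>.\<close>

definition primitive_norm :: "nat \<Rightarrow> nat \<Rightarrow> int poly \<Rightarrow> complex" where
  "primitive_norm p q F = (\<Prod>b\<in>primitive_exponents p q. ipoly F (root_of_unity (p * q) b - 1))"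

lemma multiples_below:
  assumes "p > 0"
  shows "{b\<in>{0..<int (p * q)}. int p dvd b} = (\<lambda>b. int p * b) ` {0..<int q}"
  using assms by (auto simp: zero_le_mult_iff)

lemma card_primitive_exponents:
  assumes "p > 0"
  shows "card (primitive_exponents p q) = q * (p - 1)"
proof -
  let ?J = "{0..<int (p * q)}"
  have "primitive_exponents p q = ?J - (\<lambda>b. int p * b) ` {0..<int q}"
    unfolding multiples_below[OF assms, symmetric] by (auto simp: primitive_exponents_def)
  moreover have "(\<lambda>b. int p * b) ` {0..<int q} \<subseteq> ?J"
    unfolding multiples_below[OF assms, symmetric] by auto
  moreover have "card ((\<lambda>b. int p * b) ` {0..<int q}) = q"
    using assms by (subst card_image) (auto simp: inj_on_def)
  ultimately show ?thesis
    by (simp add: card_Diff_subset diff_mult_distrib2 nat_mult_distrib mult.commute)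
qed

text \<open>The exponents divisible by \<open>p\<close> run through the roots of unity of order
  dividing \<open>q\<close>.\<close>

lemma cyclic_norm_split:
  assumes p: "p > 0" and q: "q > 0"
  shows "of_int (cyclic_norm (p * q) F) = of_int (cyclic_norm q F) * primitive_norm p q F"
proof -
  let ?J = "{0..<int (p * q)}" and ?g = "\<lambda>b. ipoly F (root_of_unity (p * q) b - 1)"
  let ?M = "{b\<in>?J. int p dvd b}"
  have "of_int (cyclic_norm (p * q) F) = (\<Prod>b\<in>?J. ?g b)"
    using p q by (simp add: cyclic_norm_eq_prod)
  also have "?J = ?M \<union> primitive_exponents p q" by (auto simp: primitive_exponents_def)
  also have "(\<Prod>b\<in>?M \<union> primitive_exponents p q. ?g b) = (\<Prod>b\<in>?M. ?g b) * primitive_norm p q F"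
    unfolding primitive_norm_def
    by (rule prod.union_disjoint) (auto simp: primitive_exponents_def intro: finite_subset[of _ ?J])
  also have "(\<Prod>b\<in>?M. ?g b) = (\<Prod>b\<in>{0..<int q}. ?g (int p * b))"
    unfolding multiples_below[OF p] using p by (subst prod.reindex) (auto simp: inj_on_def)
  also have "\<dots> = of_int (cyclic_norm q F)"
    using p q by (simp add: cyclic_norm_eq_prod root_of_unity_def mult_ac)
  finally show ?thesis .
qed

lemma primitive_norm_mult: "primitive_norm p q (F * G) = primitive_norm p q F * primitive_norm p q G"
  by (simp add: primitive_norm_def prod.distrib)

lemma primitive_norm_power: "primitive_norm p q (F ^ n) = primitive_norm p q F ^ n"
  by (simp add: primitive_norm_def prod_power_distrib)

lemma primitive_norm_const:
  assumes "p > 0"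
  shows "primitive_norm p q [:c:] = of_int c ^ (q * (p - 1))"
  using card_primitive_exponents[OF assms] by (simp add: primitive_norm_def)

text \<open>\<open>\<Psi>(T)\<close> is the cyclotomic polynomial of order \<open>p^(n+1)\<close> at \<open>1 + T\<close>, for \<open>q = p^n\<close>.\<close>
lemma cyclotomic_eisenstein:
  fixes p n :: nat
  assumes p: "prime p"
  defines "q \<equiv> p ^ n"
  obtains h \<Psi> :: "int poly" where "\<Psi> = monom 1 (q * (p - 1)) + [:int p:] * h" "coeff h 0 = 1"
    "\<And>b. b \<in> primitive_exponents p q \<Longrightarrow> ipoly \<Psi> (root_of_unity (p * q) b - 1) = 0"
proof -
  define \<Psi> :: "int poly" where "\<Psi> = (\<Sum>i<p. [:1, 1:] ^ (i * q))"
  have p0: "p > 0" and p1: "p > 1" using prime_gt_0_nat[OF p] prime_gt_1_nat[OF p] by auto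
  have q: "q > 0" using p0 by (simp add: q_def)
  obtain s where s: "monom 1 q = [:1, 1:] ^ q - 1 + [:int p:] * s"
    using X_power_prime_power[OF p] q_def by blast
  obtain s' where s': "monom 1 (p * q) = [:1, 1:] ^ (p * q) - 1 + [:int p:] * s'"
    using X_power_prime_power[OF p, of "Suc n"] by (auto simp: q_def)
  let ?\<phi> = "q * (p - 1)"
  have "([:1, 1:] ^ q - 1) * \<Psi> = ([:1, 1::int:] ^ q) ^ p - 1"
    unfolding \<Psi>_def by (simp add: power_diff_1_eq power_mult mult.commute[of _ q])
  also have "\<dots> = [:1, 1:] ^ (p * q) - 1" by (simp flip: power_mult add: mult.commute)
  finally have tele: "([:1, 1:] ^ q - 1) * \<Psi> = [:1, 1:] ^ (p * q) - 1" .
  have pq: "p * q = q + ?\<phi>" using p0 by (cases p) auto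
  \<comment> \<open>Modulo \<open>p\<close>, \<open>T^q\<close> is \<open>(1 + T)^q - 1\<close>, so
    \<open>T^q \<Psi>\<close> telescopes to \<open>(1 + T)^(p q) - 1\<close>, which is
    \<open>T^(p q)\<close>. The factor \<open>T^q\<close> is then cancelled by shifting
    coefficients.\<close>
  have "monom 1 q * (\<Psi> - monom 1 ?\<phi>) = monom 1 q * \<Psi> - monom 1 (p * q)"
    by (simp add: pq right_diff_distrib mult_monom)
  also have "\<dots> = ([:1, 1:] ^ q - 1) * \<Psi> + [:int p:] * s * \<Psi> - ([:1, 1:] ^ (p * q) - 1 + [:int p:] * s')"
    unfolding s s' by (simp only: distrib_right)
  also have "\<dots> = [:int p:] * (s * \<Psi> - s')" unfolding tele by (simp add: algebra_simps smult_diff_right)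
  finally have "[:int p:] dvd monom 1 q * (\<Psi> - monom 1 ?\<phi>)" by (rule dvdI)
  hence *: "int p dvd coeff (monom 1 q * (\<Psi> - monom 1 ?\<phi>)) i" for i
    unfolding const_poly_dvd_iff by blast
  have "int p dvd coeff (\<Psi> - monom 1 ?\<phi>) i" for i
    using *[of "i + q"] by (simp add: coeff_monom_mult)
  hence "[:int p:] dvd \<Psi> - monom 1 ?\<phi>" unfolding const_poly_dvd_iff by blast
  then obtain h where h: "\<Psi> - monom 1 ?\<phi> = [:int p:] * h" by blast
  show ?thesis
  proof (rule that)
    show "\<Psi> = monom 1 ?\<phi> + [:int p:] * h" using h by (simp add: algebra_simps)
    \<comment> \<open>Each of the \<open>p\<close> summands of \<open>\<Psi>\<close> has constant
      term 1; this is the Eisenstein condition.\<close>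
    have "coeff (\<Psi> - monom 1 ?\<phi>) 0 = int p"
      using q p1 by (simp add: \<Psi>_def coeff_sum coeff_linear_poly_power)
    thus "coeff h 0 = 1" unfolding h using p0 by simp
  next
    fix b assume b: "b \<in> primitive_exponents p q"
    let ?z = "root_of_unity (p * q) b"
    have "int (p * q) dvd int q * b \<longleftrightarrow> int p dvd b" using q by simp
    hence "?z ^ q \<noteq> 1"
      using b p0 q by (simp add: root_of_unity_power root_of_unity_eq_1_iff primitive_exponents_def)
    moreover have "(?z ^ q) ^ p = 1"
      unfolding power_mult[symmetric] using p0 q
      by (simp add: root_of_unity_power root_of_unity_eq_1_iff mult.commute[of q])
    moreover have "ipoly \<Psi> (?z - 1) = (\<Sum>i<p. (?z ^ q) ^ i)"
      by (simp add: \<Psi>_def ipoly_sum power_mult[symmetric] mult.commute[of q])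
    ultimately show "ipoly \<Psi> (?z - 1) = 0" by (simp add: geometric_sum)
  qed
qed

text \<open>At the primitive roots \<open>T^\<phi> = -p h\<close> with \<open>h\<close> of unit
  norm, and \<open>h f = T^d w\<close> with \<open>w\<close> of unit norm. So the new factor of the
  norm of \<open>f\<close> has the valuation of the new factor for \<open>T^d\<close>, which is
  \<open>d\<close>.\<close>

lemma multiplicity_cyclic_norm_Suc:
  fixes p n d :: nat
  assumes p: "prime p" and f: "f = monom 1 d + [:int p:] * g" and d: "d < p ^ n"
    and nz: "cyclic_norm (p ^ n) f \<noteq> 0" "cyclic_norm (p ^ Suc n) f \<noteq> 0"
  shows "multiplicity (int p) (cyclic_norm (p ^ Suc n) f) = d + multiplicity (int p) (cyclic_norm (p ^ n) f)"
proof -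
  define q where "q = p ^ n"
  define \<phi> where "\<phi> = q * (p - 1)"
  have p0: "p > 0" and p1: "p > 1" using prime_gt_0_nat[OF p] prime_gt_1_nat[OF p] by auto
  have q: "q > 0" using p0 by (simp add: q_def)
  have \<phi>0: "\<phi> > 0" and d\<phi>: "d < \<phi>" using p1 q d by (auto simp: \<phi>_def q_def intro: less_le_trans)
  obtain h \<Psi> :: "int poly" where \<Psi>: "\<Psi> = monom 1 \<phi> + [:int p:] * h" and h0: "coeff h 0 = 1"
    and root: "\<And>b. b \<in> primitive_exponents p q \<Longrightarrow> ipoly \<Psi> (root_of_unity (p * q) b - 1) = 0"
    using cyclotomic_eisenstein[OF p, of n] unfolding q_def \<phi>_def by metis
  \<comment> \<open>In \<open>h f = T^d h + p h g\<close>, the term \<open>p h\<close> is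
    \<open>\<Psi> - T^\<phi>\<close>; what remains beside \<open>\<Psi> g\<close> is
    \<open>T^d w\<close>. The constant term of \<open>w\<close> is that of \<open>h\<close> because
    \<open>d < \<phi>\<close>.\<close>
  define w where "w = h - monom 1 (\<phi> - d) * g"
  have w0: "coeff w 0 = 1" using d\<phi> h0 by (simp add: w_def coeff_monom_mult)
  let ?P = "primitive_norm p q" and ?N = "cyclic_norm q" and ?N' = "cyclic_norm (p * q)"
  have T: "ipoly (monom 1 k) z = z ^ k" for k z by (simp add: ipoly_def poly_monom)
  have "monom 1 d * monom 1 (\<phi> - d) = (monom 1 \<phi> :: int poly)" using d\<phi> by (simp add: mult_monom)
  hence hf: "h * f = monom 1 d * w + \<Psi> * g"
    unfolding f w_def \<Psi> by (simp add: algebra_simps smult_add_right)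
  have "?P (h * f) = ?P (monom 1 d * w)"
    unfolding primitive_norm_def hf by (rule prod.cong) (simp_all add: root)
  hence 1: "?P h * ?P f = ?P (monom 1 1) ^ d * ?P w"
    by (simp add: primitive_norm_mult primitive_norm_power[symmetric] monom_power)
  have "?P (monom 1 \<phi>) = ?P ([:- int p:] * h)"
    unfolding primitive_norm_def
  proof (rule prod.cong[OF refl])
    fix b assume b: "b \<in> primitive_exponents p q"
    have "monom 1 \<phi> = \<Psi> - [:int p:] * h" by (simp add: \<Psi>)
    thus "ipoly (monom 1 \<phi>) (root_of_unity (p * q) b - 1)
      = ipoly ([:- int p:] * h) (root_of_unity (p * q) b - 1)" using root[OF b] by simp
  qed
  \<comment> \<open>The exponent of \<open>-p\<close> is the number of primitive roots, which is
    also \<open>\<phi>\<close>.\<close>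
  hence 2: "?P (monom 1 1) ^ \<phi> = of_int (- int p) ^ \<phi> * ?P h"
    unfolding primitive_norm_mult primitive_norm_const[OF p0]
    by (simp add: primitive_norm_power[symmetric] monom_power \<phi>_def)
  \<comment> \<open>Only the power \<open>\<phi>\<close> of the new factor for \<open>T\<close> is
    known explicitly, so the identity is raised to that power.\<close>
  have "(?P h * ?P f) ^ \<phi> = (?P (monom 1 1) ^ \<phi>) ^ d * ?P w ^ \<phi>"
    unfolding 1 by (simp add: power_mult_distrib flip: power_mult) (simp add: mult.commute)
  hence 3: "?P h ^ \<phi> * ?P f ^ \<phi> = of_int (- int p) ^ (\<phi> * d) * ?P h ^ d * ?P w ^ \<phi>"
    unfolding 2 by (simp only: power_mult_distrib power_mult mult.assoc)
  have split: "(of_int (?N' F) :: complex) = of_int (?N F) * ?P F" for F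
    using p0 q by (rule cyclic_norm_split)
  \<comment> \<open>Multiplying by norms of order \<open>q\<close> turns every primitive norm into
    an integer norm of order \<open>p q\<close>.\<close>
  have "(of_int ((?N' h * ?N' f * ?N w) ^ \<phi> * ?N h ^ d) :: complex)
     = (of_int (?N h) * of_int (?N f) * of_int (?N w)) ^ \<phi> * of_int (?N h) ^ d * (?P h ^ \<phi> * ?P f ^ \<phi>)"
    by (simp add: split power_mult_distrib mult_ac)
  also have "\<dots> = of_int ((- int p) ^ (\<phi> * d) * ?N' h ^ d * (?N' w * ?N h * ?N f) ^ \<phi>)"
    unfolding 3 by (simp only: of_int_mult of_int_power split power_mult_distrib mult_ac)
  finally have eq: "(?N' h * ?N' f * ?N w) ^ \<phi> * ?N h ^ d
      = (- int p) ^ (\<phi> * d) * ?N' h ^ d * (?N' w * ?N h * ?N f) ^ \<phi>"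
    by (simp only: of_int_eq_iff)
  have pe: "prime_elem (int p)" using p by simp
  have pq: "p * q = p ^ Suc n" by (simp add: q_def)
  have unit: "\<not> int p dvd ?N F" "\<not> int p dvd ?N' F" if "coeff F 0 = 1" for F
    using cyclic_norm_unit[OF p, of F n] cyclic_norm_unit[OF p, of F "Suc n"] that p1
    unfolding pq unfolding q_def by auto
  have u0: "multiplicity (int p) (?N F) = 0" "multiplicity (int p) (?N' F) = 0" "?N F \<noteq> 0" "?N' F \<noteq> 0"
    if "coeff F 0 = 1" for F
    using unit[OF that] by (auto simp: not_dvd_imp_multiplicity_0)
  have nz': "?N f \<noteq> 0" "?N' f \<noteq> 0" using nz unfolding pq unfolding q_def by auto
  have mp: "multiplicity (int p) (- int p) = 1"
    using multiplicity_normalize_right[of "int p" "- int p"] multiplicity_self[of "int p"] p1 by simp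
  note dist = prime_elem_multiplicity_mult_distrib[OF pe] prime_elem_multiplicity_power_distrib[OF pe]
  \<comment> \<open>The norms of \<open>h\<close> and \<open>w\<close> are prime to \<open>p\<close>
    and drop out of the valuations; then \<open>\<phi> > 0\<close> is cancelled.\<close>
  have "\<phi> * multiplicity (int p) (?N' f) = \<phi> * (d + multiplicity (int p) (?N f))"
    using arg_cong[OF eq, of "multiplicity (int p)"] p0 nz' u0[OF h0] u0[OF w0]
    by (simp add: dist mp distrib_left)
  thus ?thesis using \<phi>0 unfolding pq unfolding q_def by simp
qed

section \<open>Integer approximation of p-adic power series\<close>

lemma padic_rep_mod:
  fixes a :: "'p::nontriv padic"
  assumes "k \<le> l"
  shows "padic_rep a l mod int CARD('p) ^ k = padic_rep a k"
  using padic_rep[of a] assms by (simp add: padic_set_def)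

lemma padic_rep_cong:
  fixes a :: "'p::nontriv padic"
  assumes "k \<le> l"
  shows "[padic_rep a l = padic_rep a k] (mod int CARD('p) ^ k)"
  using padic_rep_mod[OF assms, of a] padic_rep_mod[of k k a] by (simp add: cong_def)

lemma padic_rep_nonneg [simp]:
  fixes a :: "'p::nontriv padic"
  shows "padic_rep a k \<ge> 0"
proof -
  have "int CARD('p) > 0" by simp
  hence "padic_rep a k mod int CARD('p) ^ k \<ge> 0" by (simp del: zero_less_card_finite of_nat_0_less_iff)
  thus ?thesis using padic_rep_mod[of k k a] by simp
qed

definition padic_approx :: "nat \<Rightarrow> 'p::nontriv padic \<Rightarrow> int \<Rightarrow> bool" where
  "padic_approx K a z \<longleftrightarrow> [padic_rep a K = z] (mod int CARD('p) ^ K)"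

lemma padic_approx_rep: "padic_approx K a (padic_rep a K)"
  by (simp add: padic_approx_def)

lemma padic_approx_0: "padic_approx K 0 0"
  by (simp add: padic_approx_def zero_padic.rep_eq)

lemma padic_approx_1: "padic_approx K 1 1"
  by (simp add: padic_approx_def one_padic.rep_eq cong_def)

lemma padic_approx_add:
  "padic_approx K a x \<Longrightarrow> padic_approx K b y \<Longrightarrow> padic_approx K (a + b) (x + y)"
  unfolding padic_approx_def plus_padic.rep_eq by (metis cong_add cong_mod_left)

lemma padic_approx_diff:
  "padic_approx K a x \<Longrightarrow> padic_approx K b y \<Longrightarrow> padic_approx K (a - b) (x - y)"
  unfolding padic_approx_def minus_padic.rep_eq by (metis cong_diff cong_mod_left)

lemma padic_approx_mult:
  "padic_approx K a x \<Longrightarrow> padic_approx K b y \<Longrightarrow> padic_approx K (a * b) (x * y)"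
  unfolding padic_approx_def times_padic.rep_eq by (metis cong_mult cong_mod_left)

lemma padic_approx_of_nat: "padic_approx K (of_nat n) (int n)"
  by (induction n) (simp_all add: padic_approx_0 padic_approx_add padic_approx_1)

lemma padic_approx_sum:
  assumes "\<And>x. x \<in> A \<Longrightarrow> padic_approx K (f x) (g x)"
  shows "padic_approx K (sum f A) (sum g A)"
  using assms by (induction A rule: infinite_finite_induct) (auto intro: padic_approx_0 padic_approx_add)

lemma padic_approx_prod:
  assumes "\<And>x. x \<in> A \<Longrightarrow> padic_approx K (f x) (g x)"
  shows "padic_approx K (prod f A) (prod g A)"
  using assms by (induction A rule: infinite_finite_induct) (auto intro: padic_approx_1 padic_approx_mult)

lemma padic_eqI:
  fixes a b :: "'p::nontriv padic"
  assumes "\<And>k. padic_approx k a (z k)" "\<And>k. padic_approx k b (z k)"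
  shows "a = b"
proof -
  have "padic_rep a k = padic_rep b k" for k
    using assms[of k] padic_rep_mod[of k k a] padic_rep_mod[of k k b]
    by (simp add: padic_approx_def cong_def)
  thus ?thesis by (simp add: padic_rep_inject[symmetric] fun_eq_iff)
qed

section \<open>p-adic binomial coefficients by ordinary ones\<close>

text \<open>The part of \<open>p\<close> in \<open>m\<close> is at most
  \<open>m < 2^m \<le> p^m\<close>, so cancelling \<open>m\<close> costs fewer than \<open>m\<close>
  factors \<open>p\<close>.\<close>

lemma prime_power_dvd_cancel:
  fixes p m :: nat and x :: int
  assumes p: "prime p" and m: "m > 0" and dvd: "int p ^ (k + m) dvd int m * x"
  shows "int p ^ k dvd x"
proof (cases "x = 0")
  case False
  have pe: "prime_elem (int p)" and nu: "\<not> is_unit (int p)" using p by auto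
  let ?v = "multiplicity (int p)"
  have "int p ^ ?v (int m) \<le> int m"
    using m by (intro zdvd_imp_le multiplicity_dvd) auto
  moreover have "m < 2 ^ m" by (rule less_exp)
  hence "int m < 2 ^ m" by (metis of_nat_less_iff of_nat_numeral of_nat_power)
  moreover have "(2::int) ^ m \<le> int p ^ m" using prime_ge_2_nat[OF p] by (intro power_mono) auto
  ultimately have "int p ^ ?v (int m) < int p ^ m" by linarith
  hence "?v (int m) < m" using prime_gt_1_nat[OF p] by (simp add: power_strict_increasing_iff)
  moreover have "k + m \<le> ?v (int m * x)"
    using dvd False m nu by (intro multiplicity_geI) auto
  hence "k + m \<le> ?v (int m) + ?v x"
    using False m by (simp add: prime_elem_multiplicity_mult_distrib[OF pe])
  ultimately have "k \<le> ?v x" by simp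
  thus ?thesis by (rule multiplicity_dvd')
qed simp

text \<open>Gives uniqueness in the definite description \<open>padic_binom\<close>; precision
  \<open>k + m\<close> leaves \<open>k\<close> digits after cancelling \<open>m\<close>.\<close>

lemma padic_torsion_free:
  fixes c :: "'p::prime_card padic"
  assumes "m > 0" "of_nat m * c = 0"
  shows "c = 0"
proof (rule padic_eqI[where z = "\<lambda>_. 0"])
  fix k
  let ?p = "CARD('p)"
  have "padic_approx (k + m) (of_nat m * c) (int m * padic_rep c (k + m))"
    by (intro padic_approx_mult padic_approx_of_nat padic_approx_rep)
  hence "[0 = int m * padic_rep c (k + m)] (mod int ?p ^ (k + m))"
    by (simp only: padic_approx_def assms(2) zero_padic.rep_eq)
  hence "[int m * padic_rep c (k + m) = 0] (mod int ?p ^ (k + m))" by (rule cong_sym)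
  hence "int ?p ^ (k + m) dvd int m * padic_rep c (k + m)" by (rule cong_0_iff[THEN iffD1])
  hence "int ?p ^ k dvd padic_rep c (k + m)"
    by (rule prime_power_dvd_cancel[OF prime_card assms(1)])
  hence "padic_rep c k = 0" by (metis dvd_imp_mod_0 padic_rep_mod le_add1)
  thus "padic_approx k c 0" by (simp add: padic_approx_def)
qed (rule padic_approx_0)

lemma fact_times_binomial: "int (fact i) * int (x choose i) = (\<Prod>j<i. int x - int j)"
proof -
  have "real_of_int (int (fact i) * int (x choose i)) = fact i * (real x gchoose i)"
    by (simp only: of_int_mult of_int_of_nat_eq of_nat_fact of_int_fact binomial_gbinomial)
  also have "\<dots> = (\<Prod>j<i. real x - real j)"
    by (simp only: gbinomial_mult_fact atLeast0LessThan)
  also have "\<dots> = real_of_int (\<Prod>j<i. int x - int j)" by simp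
  finally show ?thesis by (simp only: of_int_eq_iff)
qed

text \<open>Continuity of binomial coefficients. The falling factorials agree to
  \<open>k + fact i\<close> digits, and dividing by \<open>fact i\<close> costs at most
  \<open>fact i\<close> of them.\<close>

lemma binomial_cong_prime_power:
  fixes p :: nat
  assumes p: "prime p" and "[int x = int y] (mod int p ^ (k + fact i))"
  shows "[int (x choose i) = int (y choose i)] (mod int p ^ k)"
proof -
  have "[(\<Prod>j<i. int x - int j) = (\<Prod>j<i. int y - int j)] (mod int p ^ (k + fact i))"
    by (intro cong_prod cong_diff assms(2) cong_refl)
  hence "int p ^ (k + fact i) dvd int (fact i) * (int (x choose i) - int (y choose i))"
    by (simp only: fact_times_binomial[symmetric] right_diff_distrib cong_iff_dvd_diff)
  hence "int p ^ k dvd int (x choose i) - int (y choose i)"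
    by (rule prime_power_dvd_cancel[OF p fact_gt_zero])
  thus ?thesis by (simp add: cong_iff_dvd_diff)
qed

text \<open>Existence of \<open>padic_binom\<close> together with its computation: ordinary
  binomials of good integer approximations to \<open>a\<close> form a compatible sequence solving
  the defining equation.\<close>

lemma padic_binom_approx:
  fixes a :: "'p::prime_card padic"
  assumes l: "l \<ge> k + fact i"
  shows "padic_approx k (padic_binom a i) (int (nat (padic_rep a l) choose i))"
proof -
  let ?p = "int CARD('p)"
  define x where "x l = nat (padic_rep a l)" for l
  \<comment> \<open>The argument is taken with \<open>fact i\<close> extra digits, enough for the
    binomial to be determined modulo \<open>p^k\<close>.\<close>
  define c where "c k = int (x (k + fact i) choose i) mod ?p ^ k" for k
  have x: "int (x l) = padic_rep a l" for l by (simp add: x_def)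
  have cong: "[int (x l choose i) = int (x (k + fact i) choose i)] (mod ?p ^ k)"
    if "l \<ge> k + fact i" for k l
    using that by (intro binomial_cong_prime_power prime_card) (simp add: x padic_rep_cong)
  have "c \<in> padic_set CARD('p)"
  proof (rule padic_set_modI)
    fix k l :: nat assume kl: "k \<le> l"
    have "c l mod ?p ^ k = int (x (l + fact i) choose i) mod ?p ^ k"
      using kl by (simp add: c_def mod_mod_cancel le_imp_power_dvd)
    also have "\<dots> = c k" using cong[of k "l + fact i"] kl by (simp add: c_def cong_def)
    finally show "c l mod ?p ^ k = c k" .
  qed
  hence rep: "padic_rep (Abs_padic c :: 'p padic) = c" by (rule Abs_padic_inverse)
  have approx: "padic_approx k (Abs_padic c :: 'p padic) (int (x l choose i))" if "l \<ge> k + fact i" for k l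
    unfolding padic_approx_def rep using cong[OF that] by (simp add: c_def cong_sym)
  have eq: "of_nat (fact i) * Abs_padic c = (\<Prod>j<i. a - of_nat j)"
  proof (rule padic_eqI)
    fix k :: nat
    let ?l = "k + fact i"
    have "padic_approx k (of_nat (fact i) * Abs_padic c :: 'p padic) (int (fact i) * int (x ?l choose i))"
      by (intro padic_approx_mult padic_approx_of_nat approx) simp
    thus "padic_approx k (of_nat (fact i) * Abs_padic c :: 'p padic) (\<Prod>j<i. padic_rep a ?l - int j)"
      by (simp only: fact_times_binomial x)
    have "padic_approx k a (padic_rep a ?l)"
      using padic_rep_cong[of k ?l a] by (simp add: padic_approx_def cong_sym)
    thus "padic_approx k (\<Prod>j<i. a - of_nat j) (\<Prod>j<i. padic_rep a ?l - int j)"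
      by (intro padic_approx_prod padic_approx_diff padic_approx_of_nat)
  qed
  have "padic_binom a i = Abs_padic c"
    unfolding padic_binom_def
  proof (rule the_equality)
    fix d assume "of_nat (fact i) * d = (\<Prod>j<i. a - of_nat j)"
    hence "of_nat (fact i) * (d - Abs_padic c) = 0" using eq by (simp add: right_diff_distrib)
    hence "d - Abs_padic c = 0" by (rule padic_torsion_free[OF fact_gt_zero])
    thus "d = Abs_padic c" by simp
  qed (rule eq)
  thus ?thesis using approx[OF l] by (simp add: x_def)
qed

section \<open>Approximation of power series by integer polynomials\<close>

text \<open>Congruence modulo \<open>(p^K, T^N)\<close>, hence compatible with the ring operations
  and with determinants.\<close>

definition fps_approx :: "nat \<Rightarrow> nat \<Rightarrow> 'p::nontriv padic fps \<Rightarrow> int poly \<Rightarrow> bool" where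
  "fps_approx K N g F \<longleftrightarrow> (\<forall>i<N. padic_approx K (fps_nth g i) (coeff F i))"

lemma fps_approx_0: "fps_approx K N 0 0"
  by (simp add: fps_approx_def padic_approx_0)

lemma fps_approx_1: "fps_approx K N 1 1"
  by (simp add: fps_approx_def padic_approx_0 padic_approx_1)

lemma fps_approx_add: "fps_approx K N g F \<Longrightarrow> fps_approx K N h H \<Longrightarrow> fps_approx K N (g + h) (F + H)"
  by (simp add: fps_approx_def padic_approx_add)

lemma fps_approx_diff: "fps_approx K N g F \<Longrightarrow> fps_approx K N h H \<Longrightarrow> fps_approx K N (g - h) (F - H)"
  by (simp add: fps_approx_def padic_approx_diff)

lemma fps_approx_uminus: "fps_approx K N g F \<Longrightarrow> fps_approx K N (- g) (- F)"
  using fps_approx_diff[OF fps_approx_0] by fastforce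

lemma fps_approx_mult:
  assumes "fps_approx K N g F" "fps_approx K N h H"
  shows "fps_approx K N (g * h) (F * H)"
  using assms unfolding fps_approx_def fps_mult_nth coeff_mult atLeast0AtMost
  by (auto intro!: padic_approx_sum padic_approx_mult)

lemma fps_approx_of_nat: "fps_approx K N (of_nat n) [:int n:]"
proof (induction n)
  case (Suc n)
  have "[:int (Suc n):] = 1 + [:int n:]" by (simp add: one_pCons)
  thus ?case using fps_approx_add[OF fps_approx_1 Suc.IH] by simp
qed (simp add: fps_approx_0)

lemma fps_approx_power: "fps_approx K N g F \<Longrightarrow> fps_approx K N (g ^ n) (F ^ n)"
  by (induction n) (auto intro: fps_approx_1 fps_approx_mult)

lemma fps_approx_sum:
  assumes "\<And>x. x \<in> A \<Longrightarrow> fps_approx K N (f x) (g x)"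
  shows "fps_approx K N (sum f A) (sum g A)"
  using assms by (induction A rule: infinite_finite_induct) (auto intro: fps_approx_0 fps_approx_add)

lemma fps_approx_prod:
  assumes "\<And>x. x \<in> A \<Longrightarrow> fps_approx K N (f x) (g x)"
  shows "fps_approx K N (prod f A) (prod g A)"
  using assms by (induction A rule: infinite_finite_induct) (auto intro: fps_approx_1 fps_approx_mult)

lemma fps_approx_sdet:
  assumes "\<And>i j. i \<in> S \<Longrightarrow> j \<in> S \<Longrightarrow> fps_approx K N (A i j) (B i j)"
  shows "fps_approx K N (sdet S A) (sdet S B)"
proof -
  have "fps_approx K N (of_int (sign q)) (of_int (sign q))" for q :: "'a \<Rightarrow> 'a"
    by (auto simp: sign_def intro: fps_approx_1 fps_approx_uminus)
  thus ?thesis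
    unfolding sdet_def
    by (intro fps_approx_sum fps_approx_mult fps_approx_prod) (auto intro!: assms simp: permutes_in_image)
qed

text \<open>Coefficientwise this is \<open>padic_binom_approx\<close>; \<open>fact N\<close> bounds
  the loss of precision for all \<open>i < N\<close> at once.\<close>

lemma fps_approx_gamma_pow:
  fixes a :: "'p::prime_card padic"
  assumes "L \<ge> K + fact N"
  shows "fps_approx K N (gamma_pow a) ([:1, 1:] ^ nat (padic_rep a L))"
  unfolding fps_approx_def
proof (intro allI impI)
  fix i assume "i < N"
  hence "(fact i :: nat) \<le> fact N" by (intro fact_mono) simp
  hence "padic_approx K (padic_binom a i) (int (nat (padic_rep a L) choose i))"
    using assms by (intro padic_binom_approx) simp
  moreover have "coeff ([:1, 1:] ^ m) i = int (m choose i)" for m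
  proof (cases "i \<le> m")
    case False
    have "degree ([:1, 1::int:] ^ m) = m" by (simp add: degree_linear_power)
    with False show ?thesis by (simp add: coeff_eq_0)
  qed (simp add: coeff_linear_poly_power)
  ultimately show "padic_approx K (fps_nth (gamma_pow a) i) (coeff ([:1, 1:] ^ nat (padic_rep a L)) i)"
    by (simp add: gamma_pow_def)
qed

lemma fps_approx_exists: "\<exists>F. fps_approx K N g F"
proof
  show "fps_approx K N g (\<Sum>i<N. monom (padic_rep (fps_nth g i) K) i)"
    by (auto simp: fps_approx_def coeff_sum coeff_monom padic_approx_rep)
qed

text \<open>The constant terms of approximations to \<open>u\<close> and to an inverse multiply to 1
  modulo \<open>p\<close>.\<close>

lemma fps_approx_unit:
  fixes u :: "'p::prime_card padic fps"
  assumes "u dvd 1" and "fps_approx K N u F" "K > 0" "N > 0"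
  shows "\<not> int CARD('p) dvd coeff F 0"
proof
  assume dvd: "int CARD('p) dvd coeff F 0"
  from assms(1) obtain v where v: "1 = u * v" by blast
  obtain G where G: "fps_approx K N v G" using fps_approx_exists by blast
  have "fps_approx K N (1 :: 'p padic fps) (F * G)" unfolding v by (intro fps_approx_mult assms G)
  hence "[padic_rep (1 :: 'p padic) K = coeff F 0 * coeff G 0] (mod int CARD('p) ^ K)"
    using assms(4) by (auto simp: fps_approx_def padic_approx_def coeff_mult)
  moreover have "[padic_rep (1 :: 'p padic) K = 1] (mod int CARD('p) ^ K)"
    using padic_approx_1 by (auto simp: padic_approx_def)
  ultimately have "[coeff F 0 * coeff G 0 = 1] (mod int CARD('p) ^ K)"
    using cong_sym cong_trans by blast
  hence "[coeff F 0 * coeff G 0 = 1] (mod int CARD('p))"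
    by (rule cong_dvd_modulus) (use assms(3) in \<open>simp add: dvd_power\<close>)
  hence "int CARD('p) dvd 1" using dvd by (meson cong_dvd_iff dvd_mult2)
  thus False using prime_card[where ?'a='p] by auto
qed

text \<open>The leading coefficient is taken as exactly 1 and the lower ones as integer residues,
  which are divisible by \<open>p\<close>. One polynomial serves for all \<open>N\<close>, and so
  for several levels of the tower.\<close>

lemma fps_approx_distinguished:
  fixes f :: "'p::prime_card padic poly"
  assumes f: "distinguished f" and K: "K > 0"
  obtains g where "\<And>N. fps_approx K N (fps_of_poly f) (monom 1 (degree f) + [:int CARD('p):] * g)"
proof -
  let ?p = "int CARD('p)" and ?d = "degree f"
  define H where "H = (\<Sum>i<?d. monom (padic_rep (coeff f i) K) i)"
  have H: "coeff H i = (if i < ?d then padic_rep (coeff f i) K else 0)" for i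
    by (auto simp: H_def coeff_sum coeff_monom)
  have "?p dvd padic_rep (coeff f i) K" if "i < ?d" for i
  proof -
    have "of_nat CARD('p) dvd coeff f i" using f that by (simp add: distinguished_def)
    then obtain c where c: "coeff f i = of_nat CARD('p) * c" by (rule dvdE)
    have "padic_approx K (coeff f i) (?p * padic_rep c K)"
      unfolding c by (intro padic_approx_mult padic_approx_of_nat padic_approx_rep)
    hence "[padic_rep (coeff f i) K = ?p * padic_rep c K] (mod ?p)"
      unfolding padic_approx_def
      by (rule cong_dvd_modulus) (use K in \<open>simp add: dvd_power\<close>)
    thus ?thesis by (simp add: cong_dvd_iff)
  qed
  hence "[:?p:] dvd H" unfolding const_poly_dvd_iff by (simp add: H)
  then obtain g where g: "H = [:?p:] * g" by blast
  show ?thesis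
  proof (rule that)
    fix N
    have "lead_coeff f = 1" using f by (simp add: distinguished_def)
    hence "padic_approx K (coeff f i) (coeff (monom 1 ?d + H) i)" for i
      by (cases i ?d rule: linorder_cases)
        (auto simp: H padic_approx_rep padic_approx_1 padic_approx_0 coeff_eq_0)
    thus "fps_approx K N (fps_of_poly f) (monom 1 ?d + [:?p:] * g)"
      unfolding g[symmetric] by (simp add: fps_approx_def)
  qed
qed

section \<open>The layers of the tower\<close>

lemma card_filter_eq_sum:
  assumes "finite D"
  shows "of_nat (card {x\<in>D. P x}) = (\<Sum>x\<in>D. if P x then 1 else (0::'a::semiring_1))"
  using assms by (simp add: sum.If_cases Int_def)

text \<open>Both numbers are divisible by the same \<open>p^k\<close> for \<open>k \<le> K\<close>,
  and the valuation of \<open>x\<close> is decided by exponents in this range.\<close>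

lemma multiplicity_cong:
  fixes p :: nat and x y :: int
  assumes p: "prime p" and x: "x \<noteq> 0" and cong: "[x = y] (mod int p ^ K)"
    and K: "multiplicity (int p) x < K"
  shows "y \<noteq> 0" "multiplicity (int p) y = multiplicity (int p) x"
proof -
  let ?v = "multiplicity (int p) x"
  have nu: "\<not> is_unit (int p)" using p by auto
  have iff: "int p ^ k dvd x \<longleftrightarrow> int p ^ k dvd y" if "k \<le> K" for k
    using cong_dvd_modulus[OF cong, of "int p ^ k"] that by (intro cong_dvd_iff) (simp add: le_imp_power_dvd)
  have 1: "int p ^ ?v dvd y" using iff[of ?v] K multiplicity_dvd[of "int p" x] by simp
  have "\<not> int p ^ Suc ?v dvd x"
    using power_dvd_iff_le_multiplicity[where p = "int p" and x = x and n = "Suc ?v"] x nu by simp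
  hence 2: "\<not> int p ^ Suc ?v dvd y" using iff[of "Suc ?v"] K by simp
  show "y \<noteq> 0" using 2 by auto
  show "multiplicity (int p) y = ?v" using 1 2 by (rule multiplicity_eqI)
qed

lemma multiplicity_of_nat:
  assumes "prime p"
  shows "multiplicity (int p) (int x) = multiplicity p x"
proof (cases "x = 0")
  case False
  have "\<not> is_unit p" using assms by auto
  hence "\<not> p ^ Suc (multiplicity p x) dvd x"
    using False power_dvd_iff_le_multiplicity[where p = p and x = x and n = "Suc (multiplicity p x)"] by simp
  moreover have "p ^ multiplicity p x dvd x" by (rule multiplicity_dvd)
  moreover have "int p ^ k dvd int x \<longleftrightarrow> p ^ k dvd x" for k
    by (metis of_nat_dvd_iff of_nat_power)
  ultimately show ?thesis by (intro multiplicity_eqI) blast+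
qed simp

text \<open>The voltage group is written additively, so the inverse voltage is a negative.\<close>

locale ramified_tower =
  fixes V :: "'v set" and E :: "'e set" and src tgt :: "'e \<Rightarrow> 'v" and rv :: "'e \<Rightarrow> 'e"
    and R :: "'v set" and \<alpha> :: "'e \<Rightarrow> 'p::prime_card padic"
  assumes graph: "fin_graph V E src tgt rv"
    and R: "R \<subseteq> V"
    and voltage: "\<And>e. e \<in> E \<Longrightarrow> \<alpha> (rv e) = - \<alpha> e"
begin

lemma prime_card_p: "prime CARD('p)" by (rule prime_card)

lemma padic_res_uminus: "padic_res (- a) n = (- padic_res (a :: 'p padic) n) mod int CARD('p) ^ n"
  by (simp add: padic_res_def uminus_padic.rep_eq)

abbreviation "Lsrc \<equiv> layer_src src R"
abbreviation "Ltgt n \<equiv> layer_tgt tgt R \<alpha> n"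
abbreviation "Lrv n \<equiv> layer_rv rv \<alpha> n"

lemma layer_graph: "fin_graph (layer_V V R (int CARD('p)) n) (layer_E E (int CARD('p)) n) Lsrc (Ltgt n) (Lrv n)"
proof -
  let ?q = "int CARD('p) ^ n"
  have q: "?q > 0" by simp
  have "layer_V V R (int CARD('p)) n \<subseteq> V \<times> {0..<?q}" using q by (auto simp: layer_V_def split: if_splits)
  hence "finite (layer_V V R (int CARD('p)) n)" using finite_V[OF graph] by (auto intro: finite_subset)
  moreover have "finite (layer_E E (int CARD('p)) n)" using finite_E[OF graph] by (simp add: layer_E_def)
  moreover have "Lsrc x \<in> layer_V V R (int CARD('p)) n \<and> Ltgt n x \<in> layer_V V R (int CARD('p)) n \<and> Lrv n x \<in> layer_E E (int CARD('p)) n \<and> Lrv n x \<noteq> x \<and>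
    Lrv n (Lrv n x) = x \<and> Lsrc (Lrv n x) = Ltgt n x" if "x \<in> layer_E E (int CARD('p)) n" for x
  proof -
    obtain e g where xeg: "x = (e, g)" by (cases x)
    with that have x: "x = (e, g)" "e \<in> E" "0 \<le> g" "g < ?q" by (auto simp: layer_E_def)
    note ge = fin_graph_simps[OF graph x(2)]
    \<comment> \<open>Reversing twice shifts the sheet by opposite voltages, hence not at all modulo
      \<open>p^n\<close>.\<close>
    have "(g + padic_res (\<alpha> e) n + padic_res (\<alpha> (rv e)) n) mod ?q = g mod ?q"
      by (simp add: voltage[OF x(2)] padic_res_uminus mod_add_right_eq)
    hence "Lrv n (Lrv n x) = x"
      using x ge by (simp add: layer_rv_def mod_add_left_eq)
    thus ?thesis using x ge q
      by (auto simp: layer_V_def layer_E_def layer_src_def layer_tgt_def layer_rv_def)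
  qed
  ultimately show ?thesis by (simp add: fin_graph_def)
qed

lemma layer_R_subset: "layer_R R \<subseteq> layer_V V R (int CARD('p)) n"
  using R by (auto simp: layer_R_def layer_V_def)

lemma layer_unramified: "layer_V V R (int CARD('p)) n - layer_R R = (V - R) \<times> {0..<int (CARD('p) ^ n)}"
  by (auto simp: layer_R_def layer_V_def split: if_splits)

abbreviation "outdeg v \<equiv> card {e\<in>E. src e = v}"

text \<open>Each edge at \<open>v\<close> has one lift starting at \<open>(v, a)\<close>, and it
  ends on the sheet shifted by the voltage. Entries thus depend only on the difference of sheets:
  the matrix is block circulant.\<close>

lemma layer_laplacian:
  assumes v: "v \<in> V - R" and w: "w \<in> V - R" and a: "a \<in> {0..<int (CARD('p) ^ n)}"
  shows "laplacian (layer_E E (int CARD('p)) n) Lsrc (Ltgt n) (v, a) (w, b) = (if (v, a) = (w, b) then int (outdeg v) else 0)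
    - (\<Sum>e\<in>{e\<in>E. src e = v \<and> tgt e = w}. if (a + padic_res (\<alpha> e) n) mod int (CARD('p) ^ n) = b then 1 else 0)"
proof -
  have "{x\<in>layer_E E (int CARD('p)) n. Lsrc x = (v, a)} = (\<lambda>e. (e, a)) ` {e\<in>E. src e = v}"
    using v a by (auto simp: layer_E_def layer_src_def)
  hence "card {x\<in>layer_E E (int CARD('p)) n. Lsrc x = (v, a)} = outdeg v" by (simp add: card_image inj_on_def)
  moreover have "{x\<in>layer_E E (int CARD('p)) n. Lsrc x = (v, a) \<and> Ltgt n x = (w, b)} =
    (\<lambda>e. (e, a)) ` {e\<in>{e\<in>E. src e = v \<and> tgt e = w}. (a + padic_res (\<alpha> e) n) mod int (CARD('p) ^ n) = b}"
    using v w a by (auto simp: layer_E_def layer_src_def layer_tgt_def)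
  hence "card {x\<in>layer_E E (int CARD('p)) n. Lsrc x = (v, a) \<and> Ltgt n x = (w, b)} =
    card {e\<in>{e\<in>E. src e = v \<and> tgt e = w}. (a + padic_res (\<alpha> e) n) mod int (CARD('p) ^ n) = b}"
    by (simp only:) (rule card_image, auto simp: inj_on_def)
  moreover have "finite {e\<in>E. src e = v \<and> tgt e = w}" using finite_E[OF graph] by simp
  ultimately show ?thesis unfolding laplacian_def by (simp only: card_filter_eq_sum)
qed

abbreviation "forests n \<equiv> forest_count (layer_V V R (int CARD('p)) n) (layer_E E (int CARD('p)) n) Lsrc (Ltgt n) (Lrv n) (layer_R R)"

text \<open>The matrix \<open>M\<^sub>\<alpha>\<close> restricted to the unramified vertices and transposed, with \<open>\<gamma>\<^sup>\<alpha>\<close>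
  replaced by \<open>(1 + T)^A\<close> for nonnegative integer voltages \<open>A\<close>.\<close>
definition voltage_matrix :: "('e \<Rightarrow> nat) \<Rightarrow> 'v \<Rightarrow> 'v \<Rightarrow> int poly" where
  "voltage_matrix A v w = (if v = w then [:int (outdeg v):] else 0)
     - (\<Sum>e\<in>{e\<in>E. src e = v \<and> tgt e = w}. [:1, 1:] ^ A e)"

text \<open>The Fourier transform of the layer Laplacian has as blocks the values of
  \<open>voltage_matrix A\<close> at \<zeta> - 1. Evaluation commutes with determinants, so the
  product over all \<zeta> is a norm.\<close>

lemma forests_eq_cyclic_norm:
  assumes A: "\<And>e. e \<in> E \<Longrightarrow> int (A e) mod int CARD('p) ^ n = padic_res (\<alpha> e) n"
  shows "int (forests n) = cyclic_norm (CARD('p) ^ n) (sdet (V - R) (voltage_matrix A))"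
proof -
  let ?m = "CARD('p) ^ n" and ?U = "V - R"
  let ?J = "{0..<int ?m}"
  let ?L = "laplacian (layer_E E (int CARD('p)) n) Lsrc (Ltgt n)"
  let ?g = "\<lambda>b v w. ipoly (voltage_matrix A v w) (root_of_unity ?m b - 1)"
  have m: "?m > 0" by simp
  have "int (forests n) = sdet (?U \<times> ?J) ?L"
    using matrix_forest[OF layer_graph layer_R_subset] by (simp only: layer_unramified)
  moreover have "of_int (sdet (?U \<times> ?J) ?L) = (\<Prod>b\<in>?J. sdet ?U (?g b))"
  proof (rule sdet_block_circulant)
    fix v w a b assume v: "v \<in> ?U" and w: "w \<in> ?U" and a: "a \<in> ?J" and b: "b \<in> ?J"
    let ?D = "{e\<in>E. src e = v \<and> tgt e = w}" and ?r = "\<lambda>k. root_of_unity ?m (k * b)"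
    let ?t = "\<lambda>e. (a + padic_res (\<alpha> e) n) mod int ?m"
    \<comment> \<open>Shifting by the voltage multiplies a character by one of its values, and the
      integer voltage matters only modulo \<open>p^n\<close>.\<close>
    have res: "?r (?t e) = ?r a * root_of_unity ?m b ^ A e" if "e \<in> ?D" for e
    proof -
      have "?r (?t e) = ?r (a + padic_res (\<alpha> e) n)"
        using m by (rule root_of_unity_mod_mult)
      also have "\<dots> = ?r a * ?r (padic_res (\<alpha> e) n)"
        by (simp add: distrib_right root_of_unity_add)
      also have "?r (padic_res (\<alpha> e) n) = ?r (int (A e) mod int ?m)"
        using A[of e] that by simp
      also have "\<dots> = ?r (int (A e))"
        using m by (rule root_of_unity_mod_mult)
      finally show ?thesis by (simp add: root_of_unity_power)
    qed
    have of_count: "of_int (\<Sum>e\<in>?D. if P e then 1 else 0) * z = (\<Sum>e\<in>?D. if P e then z else 0)"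
      for P and z :: complex
      unfolding of_int_sum sum_distrib_right by (intro sum.cong refl) simp
    have "(\<Sum>c\<in>?J. of_int (?L (v, a) (w, c)) * ?r c) =
      (\<Sum>c\<in>?J. if v = w then if a = c then of_nat (outdeg v) * ?r c else 0 else 0)
      - (\<Sum>c\<in>?J. \<Sum>e\<in>?D. if ?t e = c then ?r c else 0)"
      unfolding layer_laplacian[OF v w a] sum_subtractf[symmetric] of_int_diff left_diff_distrib of_count
      by (intro sum.cong refl) auto
    also have "(\<Sum>c\<in>?J. if v = w then if a = c then of_nat (outdeg v) * ?r c else 0 else 0)
      = (if v = w then of_nat (outdeg v) * ?r a else 0)" using a by (simp add: sum.delta')
    also have "(\<Sum>c\<in>?J. \<Sum>e\<in>?D. if ?t e = c then ?r c else 0) = (\<Sum>e\<in>?D. \<Sum>c\<in>?J. if ?t e = c then ?r c else 0)"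
      by (rule sum.swap)
    also have "\<dots> = (\<Sum>e\<in>?D. ?r a * root_of_unity ?m b ^ A e)"
    proof (rule sum.cong[OF refl])
      fix e assume e: "e \<in> ?D"
      have "?t e \<in> ?J" using m by simp
      hence "(\<Sum>c\<in>?J. if ?t e = c then ?r c else 0) = ?r (?t e)" by (simp only: sum.delta' finite_atLeastLessThan_int if_True)
      thus "(\<Sum>c\<in>?J. if ?t e = c then ?r c else 0) = ?r a * root_of_unity ?m b ^ A e"
        using res[OF e] by simp
    qed
    finally show "(\<Sum>c\<in>?J. of_int (?L (v, a) (w, c)) * ?r c) = ?r a * ?g b v w"
      by (simp add: voltage_matrix_def ipoly_sum sum_distrib_left right_diff_distrib mult.commute)
  qed (use finite_V[OF graph] m in auto)
  moreover have "sdet ?U (?g b) = ipoly (sdet ?U (voltage_matrix A)) (root_of_unity ?m b - 1)" for b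
    by (rule sdet_hom[symmetric]) auto
  ultimately have "(of_int (int (forests n)) :: complex) = of_int (cyclic_norm ?m (sdet ?U (voltage_matrix A)))"
    unfolding cyclic_norm_eq_prod[OF m] by simp
  thus ?thesis by (simp only: of_int_eq_iff)
qed

text \<open>The columns of ramified vertices are unit vectors, so only the block of
  \<open>V - R\<close> counts. It is transposed because \<open>M_alpha\<close> puts the source of an
  edge in the column.\<close>

lemma M_alpha_approx:
  assumes vs: "distinct vs" "set vs = V"
    and A: "\<And>e. e \<in> E \<Longrightarrow> fps_approx K N (gamma_pow (\<alpha> e)) ([:1, 1:] ^ A e)"
  shows "fps_approx K N (det (M_alpha vs E src tgt R \<alpha>)) (sdet (V - R) (voltage_matrix A))"
proof -
  define B :: "'v \<Rightarrow> 'v \<Rightarrow> 'p padic fps" where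
    "B x y = (if x = y then (if x \<in> R then 1 else of_nat (outdeg x)) else 0)
      - (if y \<in> R then 0 else (\<Sum>e\<in>{e\<in>E. src e = y \<and> tgt e = x}. gamma_pow (\<alpha> e)))" for x y
  define B' :: "'v \<Rightarrow> 'v \<Rightarrow> int poly" where
    "B' x y = (if x = y then (if x \<in> R then 1 else [:int (outdeg x):]) else 0)
      - (if y \<in> R then 0 else (\<Sum>e\<in>{e\<in>E. src e = y \<and> tgt e = x}. [:1, 1:] ^ A e))" for x y
  have bij: "bij_betw (nth vs) {0..<length vs} V"
    using bij_betw_nth[OF vs(1) refl vs(2)[symmetric]] by (simp add: atLeast0LessThan)
  have "M_alpha vs E src tgt R \<alpha> = mat (length vs) (length vs) (\<lambda>(i, j). B (vs ! i) (vs ! j))"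
    unfolding M_alpha_def by (rule eq_matI) (auto simp: B_def nth_eq_iff_index_eq[OF vs(1)])
  hence det: "det (M_alpha vs E src tgt R \<alpha>) = sdet V B" by (simp add: sdet_eq_det[OF bij])
  have fin: "finite (V - R)" "finite R"
    using finite_V[OF graph] R by (auto intro: finite_subset)
  have "sdet V B' = sdet ((V - R) \<union> R) B'" using R by (simp add: Un_absorb2)
  also have "\<dots> = sdet (V - R) B' * sdet R B'"
    using fin by (intro sdet_block_triangular) (auto simp: B'_def)
  also have "sdet R B' = 1" using fin by (subst sdet_diagonal) (auto simp: B'_def)
  also have "sdet (V - R) B' = sdet (V - R) (\<lambda>x y. voltage_matrix A y x)"
    by (rule sdet_cong) (auto simp: B'_def voltage_matrix_def)
  also have "\<dots> = sdet (V - R) (voltage_matrix A)" by (rule sdet_transpose[OF fin(1)])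
  finally have "sdet (V - R) (voltage_matrix A) = sdet V B'" by simp
  moreover have "fps_approx K N (sdet V B) (sdet V B')"
    unfolding B_def B'_def
    by (intro fps_approx_sdet fps_approx_diff)
      (auto intro!: fps_approx_0 fps_approx_1 fps_approx_of_nat fps_approx_sum A)
  ultimately show ?thesis by (simp add: det)
qed

section \<open>Valuations of the forest counts\<close>

text \<open>The factorisation of the determinant passes to norms of integer approximations;
  \<open>u\<close> is the norm of an approximation to the unit \<open>U\<close>.\<close>

lemma forests_cong:
  assumes vs: "distinct vs" "set vs = V"
    and decomp: "det (M_alpha vs E src tgt R \<alpha>) = (of_nat CARD('p)) ^ \<mu> * U * fps_of_poly f"
    and unit: "U dvd 1" and K: "K > 0"
    and F: "\<And>N. fps_approx K N (fps_of_poly f) F"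
  shows "\<exists>u. \<not> int CARD('p) dvd u \<and>
    [int (forests n) = int CARD('p) ^ (\<mu> * CARD('p) ^ n) * u * cyclic_norm (CARD('p) ^ n) F] (mod int CARD('p) ^ K)"
proof -
  let ?m = "CARD('p) ^ n"
  have m: "?m > 0" by simp
  \<comment> \<open>The order in \<open>T\<close> beyond which coefficients do not affect the norm
    modulo \<open>p^K\<close>.\<close>
  define N where "N = K * ?m"
  have N: "N > 0" using K m by (simp add: N_def)
  \<comment> \<open>Enough digits of the voltages both for the power series modulo
    \<open>(p^K, T^N)\<close> and for the sheets modulo \<open>p^n\<close>.\<close>
  define L where "L = K + fact N + n"
  define A where "A e = nat (padic_rep (\<alpha> e) L)" for e
  obtain W where W: "fps_approx K N U W" using fps_approx_exists by blast
  let ?G = "sdet (V - R) (voltage_matrix A)" and ?H = "[:int CARD('p):] ^ \<mu> * W * F"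
  have "fps_approx K N (det (M_alpha vs E src tgt R \<alpha>)) ?G"
    using vs unfolding A_def L_def by (intro M_alpha_approx fps_approx_gamma_pow) auto
  hence G: "[padic_rep (fps_nth (of_nat CARD('p) ^ \<mu> * U * fps_of_poly f) i) K = coeff ?G i] (mod int CARD('p) ^ K)"
    if "i < N" for i
    using that unfolding decomp fps_approx_def padic_approx_def by blast
  have "fps_approx K N (of_nat CARD('p) ^ \<mu> * U * fps_of_poly f) ?H"
    by (intro fps_approx_mult fps_approx_power fps_approx_of_nat W F)
  hence H: "[padic_rep (fps_nth (of_nat CARD('p) ^ \<mu> * U * fps_of_poly f) i) K = coeff ?H i] (mod int CARD('p) ^ K)"
    if "i < N" for i
    using that unfolding fps_approx_def padic_approx_def by blast
  have coeffs: "int CARD('p) ^ K dvd coeff ?G i - coeff ?H i" if "i < K * ?m" for i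
    using cong_trans[OF cong_sym[OF G] H] that unfolding N_def cong_iff_dvd_diff by blast
  have GH: "[cyclic_norm ?m ?G = cyclic_norm ?m ?H] (mod int CARD('p) ^ K)"
    by (rule cyclic_norm_truncate[OF prime_card_p coeffs])
  have fG: "int (forests n) = cyclic_norm ?m ?G"
  proof (rule forests_eq_cyclic_norm)
    fix e
    show "int (A e) mod int CARD('p) ^ n = padic_res (\<alpha> e) n"
      using padic_rep_mod[of n L "\<alpha> e"] by (simp add: A_def L_def padic_res_def)
  qed
  have Hm: "cyclic_norm ?m ?H = int CARD('p) ^ (\<mu> * ?m) * cyclic_norm ?m W * cyclic_norm ?m F"
  proof -
    have "[:int CARD('p):] ^ \<mu> = [:int CARD('p) ^ \<mu>:]" by (induction \<mu>) (simp_all add: one_pCons)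
    thus ?thesis by (simp only: cyclic_norm_mult[OF m] cyclic_norm_const[OF m] power_mult)
  qed
  have "\<not> int CARD('p) dvd cyclic_norm ?m W"
    using fps_approx_unit[OF unit W K N] by (rule cyclic_norm_unit[OF prime_card_p])
  thus ?thesis using GH unfolding fG Hm by blast
qed

lemma multiplicity_forests_Suc:
  assumes vs: "distinct vs" "set vs = V"
    and decomp: "det (M_alpha vs E src tgt R \<alpha>) = (of_nat CARD('p)) ^ \<mu> * U * fps_of_poly f"
    and unit: "U dvd 1" and dist: "distinguished f"
    and pos: "forests n > 0" "forests (Suc n) > 0"
    and n: "degree f \<le> n"
  shows "int (multiplicity CARD('p) (forests (Suc n))) - int \<mu> * int CARD('p) ^ Suc n
    = int (multiplicity CARD('p) (forests n)) - int \<mu> * int CARD('p) ^ n + int (degree f)"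
proof -
  let ?v = "multiplicity (int CARD('p))"
  have pe: "prime_elem (int CARD('p))" using prime_card_p by simp
  \<comment> \<open>Larger than both valuations, so congruences modulo \<open>p^K\<close> determine
    them.\<close>
  define K where "K = Suc (max (?v (int (forests n))) (?v (int (forests (Suc n)))))"
  have K: "K > 0" by (simp add: K_def)
  obtain g where F: "\<And>N. fps_approx K N (fps_of_poly f) (monom 1 (degree f) + [:int CARD('p):] * g)"
    using fps_approx_distinguished[OF dist K] by blast
  define F where "F = monom 1 (degree f) + [:int CARD('p):] * g"
  have val: "cyclic_norm (CARD('p) ^ k) F \<noteq> 0 \<and>
    ?v (int (forests k)) = \<mu> * CARD('p) ^ k + ?v (cyclic_norm (CARD('p) ^ k) F)"
    if k: "forests k > 0" "?v (int (forests k)) < K" for k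
  proof -
    obtain u where u: "\<not> int CARD('p) dvd u"
      and cong: "[int (forests k) = int CARD('p) ^ (\<mu> * CARD('p) ^ k) * u * cyclic_norm (CARD('p) ^ k) F] (mod int CARD('p) ^ K)"
      using forests_cong[OF vs decomp unit K F] unfolding F_def by blast
    let ?y = "int CARD('p) ^ (\<mu> * CARD('p) ^ k) * u * cyclic_norm (CARD('p) ^ k) F"
    have y: "?y \<noteq> 0" "?v ?y = ?v (int (forests k))"
      using multiplicity_cong[OF prime_card_p _ cong] k by auto
    have u0: "u \<noteq> 0" "?v u = 0" using u by (auto simp: not_dvd_imp_multiplicity_0)
    have "?v (int CARD('p) ^ (\<mu> * CARD('p) ^ k)) = \<mu> * CARD('p) ^ k"
      using pe by (intro multiplicity_same_power) auto
    thus ?thesis using y u0 by (auto simp: prime_elem_multiplicity_mult_distrib[OF pe])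
  qed
  \<comment> \<open>The crude bound \<open>n < 2^n \<le> p^n\<close> turns
    \<open>degree f \<le> n\<close> into the hypothesis on \<open>d\<close> in
    \<open>multiplicity_cyclic_norm_Suc\<close>.\<close>
  have "degree f < CARD('p) ^ n"
  proof -
    have "n < 2 ^ n" by (rule less_exp)
    also have "(2::nat) ^ n \<le> CARD('p) ^ n" using prime_ge_2_nat[OF prime_card_p] by (intro power_mono) auto
    finally show ?thesis using n by simp
  qed
  moreover have v1: "cyclic_norm (CARD('p) ^ n) F \<noteq> 0 \<and>
      ?v (int (forests n)) = \<mu> * CARD('p) ^ n + ?v (cyclic_norm (CARD('p) ^ n) F)"
    and v2: "cyclic_norm (CARD('p) ^ Suc n) F \<noteq> 0 \<and>
      ?v (int (forests (Suc n))) = \<mu> * CARD('p) ^ Suc n + ?v (cyclic_norm (CARD('p) ^ Suc n) F)"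
    using pos by (intro val; simp add: K_def)+
  ultimately have "?v (cyclic_norm (CARD('p) ^ Suc n) F) = degree f + ?v (cyclic_norm (CARD('p) ^ n) F)"
    by (intro multiplicity_cyclic_norm_Suc[OF prime_card_p F_def]) auto
  moreover have "multiplicity CARD('p) x = ?v (int x)" for x
    by (rule multiplicity_of_nat[OF prime_card_p, symmetric])
  ultimately show ?thesis using v1 v2 by simp
qed

end

theorem theorem6p8:
  fixes V :: "'v set" and E :: "'e set" and src tgt :: "'e \<Rightarrow> 'v" and rv :: "'e \<Rightarrow> 'e"
    and R :: "'v set" and \<alpha> :: "'e \<Rightarrow> 'p::prime_card padic" and vs :: "'v list"
    and \<mu> :: nat and U :: "'p padic fps" and f :: "'p padic poly"
  assumes graph: "fin_graph V E src tgt rv"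
    and conn: "graph_connected V E src tgt"
    and ram: "R \<subseteq> V" "card R \<in> {1, 2}"
    and shared: "admissible_paths_share_edges E src tgt rv R"
    and voltage: "\<forall>e\<in>E. \<alpha> (rv e) = - \<alpha> e"
    and layers_connected: "\<forall>n. graph_connected (layer_V V R (int CARD('p)) n)
        (layer_E E (int CARD('p)) n) (layer_src src R) (layer_tgt tgt R \<alpha> n)"
    and order: "distinct vs" "set vs = V"
      "\<forall>i j. i < j \<longrightarrow> j < length vs \<longrightarrow> vs ! i \<in> R \<longrightarrow> vs ! j \<in> R"
    and decomp: "det (M_alpha vs E src tgt R \<alpha>) = (of_nat CARD('p)) ^ \<mu> * U * fps_of_poly f"
    and unit: "U dvd 1"
    and dist: "distinguished f"
  shows "\<exists>\<nu>::int. \<exists>N. \<forall>n\<ge>N.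
    int (multiplicity CARD('p)
      (forest_count (layer_V V R (int CARD('p)) n) (layer_E E (int CARD('p)) n)
         (layer_src src R) (layer_tgt tgt R \<alpha> n) (layer_rv rv \<alpha> n) (layer_R R)))
    = int \<mu> * int CARD('p) ^ n + int (degree f) * int n + \<nu>"
proof -
  interpret ramified_tower V E src tgt rv R \<alpha>
    by unfold_locales (use graph ram voltage in auto)
  \<comment> \<open>With a root available, connectedness of the layers makes all forest counts
    nonzero.\<close>
  have "R \<noteq> {}" using ram(2) by auto
  hence pos: "forests n > 0" for n
    using layers_connected by (intro forest_count_pos[OF layer_graph _ layer_R_subset]) (auto simp: layer_R_def)
  \<comment> \<open>Without the term \<open>\<mu> p^n\<close> the valuation is, from
    \<open>n = degree f\<close> on, an arithmetic progression with difference
    \<open>degree f\<close>; its value at that index fixes the constant.\<close>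
  let ?v = "\<lambda>n. int (multiplicity CARD('p) (forests n)) - int \<mu> * int CARD('p) ^ n"
  let ?d = "degree f"
  have step: "?v (Suc n) = ?v n + int ?d" if "n \<ge> ?d" for n
    using multiplicity_forests_Suc[OF order(1,2) decomp unit dist pos pos that] .
  have "?v n = int ?d * int n + (?v ?d - int ?d * int ?d)" if "n \<ge> ?d" for n
    using that
  proof (induction n rule: dec_induct)
    case (step n)
    thus ?case using \<open>n \<ge> ?d \<Longrightarrow> ?v (Suc n) = ?v n + int ?d\<close> by (simp add: algebra_simps)
  qed simp
  hence "\<forall>n\<ge>?d. int (multiplicity CARD('p) (forests n))
      = int \<mu> * int CARD('p) ^ n + int ?d * int n + (?v ?d - int ?d * int ?d)"
    by (simp add: algebra_simps)
  thus ?thesis by blast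
qed

end
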